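(* Let the plant $\dot x=f(x,u)$ with steady-state map $h:\mathbb{R}^p\to\mathbb{R}^n$ satisfy the Plant Assumption. Let $\Phi:\mathbb{R}^n\times\mathbb{R}^p\to\mathbb{R}$ be continuously differentiable with locally Lipschitz gradient, let $Q,D:\mathbb{R}^p\to\mathbb{S}^p_+$ be continuous, and let $L>0$ be such that $$\left\| H(u)^T\left(\nabla\Phi(x',u)^T-\nabla\Phi(x,u)^T\right)\right\|\le L\|x'-x\|\qquad\text{for all } x,x'\in\mathbb{R}^n,\ u\in\mathbb{R}^p .$$ Let $W:\mathbb{R}^n\times\mathbb{R}^p\to\mathbb{R}$ be a Lyapunov function for the plant with constants $\alpha,\beta,\gamma,\zeta>0$ as defined in the context. Suppose that $\tilde\Phi(u):=\Phi(h(u),u)$ has compact sublevel sets and that $$\frac{\sup_{u\in\mathbb{R}^p}\left(\lambda^{\max}_{Q(u)}\right)^2}{\inf_{u\in\mathbb{R}^p}\lambda^{\min}_{D(u)}}<\frac{\gamma}{\zeta L}.$$ Then all trajectories of $$\dot x=f(x,u),\qquad \dot u=Q(u)z,\qquad \dot z=-D(u)z-Q(u)H(u)^T\,\nabla\Phi(x,u)^T$$ (with $z\in\mathbb{R}^p$) converge asymptotically to the set of points $(x^\star,u^\star,z^\star)$ for which $z^\star=0$ and $(x^\star,u^\star)$ is a critical point of the problem $\min_{x,u}\{\Phi(x,u)\mid x=h(u)\}$.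
   Context: Notation: $\nabla$ denotes the Jacobian (a row vector for scalar functions), so $\nabla\Phi(x,u)^T\in\mathbb{R}^{n+p}$ is the gradient of $\Phi$ with respect to $(x,u)$. $\|\cdot\|$ is the Euclidean norm or the induced matrix norm. $\mathbb{S}^p_+$ is the set of symmetric positive definite $p\times p$ matrices; $\lambda^{\max}_A,\lambda^{\min}_A$ are the maximum and minimum eigenvalues of a symmetric matrix $A$. $H(u)^T:=\begin{bmatrix}\nabla h(u)^T & I_p\end{bmatrix}\in\mathbb{R}^{p\times(n+p)}$. Plant Assumption: $f:\mathbb{R}^n\times\mathbb{R}^p\to\mathbb{R}^n$ is continuously differentiable, $\ell_x$-Lipschitz in $x$ and $\ell_u$-Lipschitz in $u$. The map $h:\mathbb{R}^p\to\mathbb{R}^n$ is continuously differentiable, $\ell$-Lipschitz, and satisfies $f(h(u),u)=0$ for all $u\in\mathbb{R}^p$. There exist $\tau,K>0$ such that for every $x_0\in\mathbb{R}^n$ and every constant $\hat u\in\mathbb{R}^p$ the solution of $\dot x=f(x,\hat u)$, $x(0)=x_0$, satisfies $\|x(t)-h(\hat u)\|\le K\|x_0-h(\hat u)\|e^{-\tau t}$ for all $t\ge 0$. Lyapunov function $W$ with constants $\alpha,\beta,\gamma,\zeta>0$: $W$ is differentiable and for all $(x,u)$: $\alpha\|x-h(u)\|^2\le W(x,u)\le\beta\|x-h(u)\|^2$, $\ \nabla_xW(x,u)f(x,u)\le-\gamma\|x-h(u)\|^2$, $\ \|\nabla_uW(x,u)\|\le\zeta\|x-h(u)\|$. Critical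 point of $\min\{\Phi(x,u)\mid x=h(u)\}$: a point $(x^\star,u^\star)$ with $x^\star=h(u^\star)$ for which there is $\lambda\in\mathbb{R}^n$ with $\nabla\Phi(x^\star,u^\star)^T+\begin{bmatrix}I_n\\-\nabla h(u^\star)^T\end{bmatrix}\lambda=0$. *)

theory Defs
  imports "HOL-Analysis.Analysis"
begin

subsection \<open>Calculus and linear algebra\<close>

text \<open>The space of pairs \<open>(real^'n) \<times> (real^'p)\<close>, which carries the Euclidean inner product
  and norm, plays the role of \<open>\<real>\<^sup>n\<^sup>+\<^sup>p\<close>.\<close>

definition continuously_differentiable ::
  "('a::real_normed_vector \<Rightarrow> 'b::real_normed_vector) \<Rightarrow> bool" where
  "continuously_differentiable F \<longleftrightarrow>
     (\<exists>F'. (\<forall>z. (F has_derivative blinfun_apply (F' z)) (at z)) \<and> continuous_on UNIV F')"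

text \<open>Meaningful only where \<open>F\<close> is differentiable.\<close>

definition gradient :: "('a::euclidean_space \<Rightarrow> real) \<Rightarrow> 'a \<Rightarrow> 'a" where
  "gradient F z = (THE g. GDERIV F z :> g)"

definition locally_lipschitz :: "('a::metric_space \<Rightarrow> 'b::metric_space) \<Rightarrow> bool" where
  "locally_lipschitz F \<longleftrightarrow> (\<forall>z. \<exists>e>0. \<exists>M. M-lipschitz_on (ball z e) F)"

definition pos_def_matrices :: "(real^'p^'p) set" where
  "pos_def_matrices = {A. transpose A = A \<and> (\<forall>v. v \<noteq> 0 \<longrightarrow> 0 < v \<bullet> (A *v v))}"

definition eigenvalues :: "real^'p^'p \<Rightarrow> real set" where
  "eigenvalues A = {c. \<exists>v. v \<noteq> 0 \<and> A *v v = c *\<^sub>R v}"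

definition lambda_max :: "real^'p^'p \<Rightarrow> real" where
  "lambda_max A = Max (eigenvalues A)"

definition lambda_min :: "real^'p^'p \<Rightarrow> real" where
  "lambda_min A = Min (eigenvalues A)"

subsection \<open>Trajectories\<close>

definition solves_on :: "real set \<Rightarrow> ('s::real_normed_vector \<Rightarrow> 's) \<Rightarrow> (real \<Rightarrow> 's) \<Rightarrow> bool" where
  "solves_on I F y \<longleftrightarrow> (\<forall>t\<in>I. (y has_vector_derivative F (y t)) (at t within I))"

definition time_interval :: "ereal \<Rightarrow> real set" where
  "time_interval T = {t. 0 \<le> t \<and> ereal t < T}"

text \<open>A trajectory is a solution that cannot be continued to the right, with lifetime
  \<open>T \<in> (0, \<infinity>]\<close>; global existence is not presupposed. No uniqueness is assumed either (the
  right-hand side of the closed loop need not be locally Lipschitz). The values of \<open>y\<close> outside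
  \<open>time_interval T\<close> are irrelevant.\<close>

definition trajectory ::
  "('s::real_normed_vector \<Rightarrow> 's) \<Rightarrow> ereal \<Rightarrow> (real \<Rightarrow> 's) \<Rightarrow> bool" where
  "trajectory F T y \<longleftrightarrow>
     0 < T \<and> solves_on (time_interval T) F y \<and>
     \<not> (\<exists>T' y'. T < T' \<and> solves_on (time_interval T') F y' \<and>
              (\<forall>t\<in>time_interval T. y' t = y t))"

text \<open>The distance from \<open>y t\<close> to \<open>S\<close> tends to 0; stated without \<open>infdist\<close>, which is 0 for
  empty \<open>S\<close>.\<close>

definition converges_to_set :: "(real \<Rightarrow> 's::metric_space) \<Rightarrow> 's set \<Rightarrow> bool" where
  "converges_to_set y S \<longleftrightarrow> (\<forall>e>0. \<forall>\<^sub>F t in at_top. \<exists>s\<in>S. dist (y t) s < e)"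

subsection \<open>Plant, Lyapunov function, optimization problem\<close>

definition plant_assumption ::
  "((real^'n) \<times> (real^'p) \<Rightarrow> real^'n) \<Rightarrow> (real^'p \<Rightarrow> real^'n) \<Rightarrow> real \<Rightarrow> real \<Rightarrow> real \<Rightarrow> bool" where
  "plant_assumption f h lx lu l \<longleftrightarrow>
     continuously_differentiable f \<and>
     (\<forall>u. lx-lipschitz_on UNIV (\<lambda>x. f (x, u))) \<and>
     (\<forall>x. lu-lipschitz_on UNIV (\<lambda>u. f (x, u))) \<and>
     continuously_differentiable h \<and>
     l-lipschitz_on UNIV h \<and>
     (\<forall>u. f (h u, u) = 0) \<and>
     (\<exists>\<tau>>0. \<exists>K>0. \<forall>x0 u X.
        solves_on {0..} (\<lambda>x. f (x, u)) X \<and> X 0 = x0 \<longrightarrow>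
        (\<forall>t\<ge>0. norm (X t - h u) \<le> K * norm (x0 - h u) * exp (- \<tau> * t)))"

text \<open>The components of the gradient on the product are the partial gradients with respect to
  \<open>x\<close> and \<open>u\<close>.\<close>

definition lyapunov_function ::
  "((real^'n) \<times> (real^'p) \<Rightarrow> real^'n) \<Rightarrow> (real^'p \<Rightarrow> real^'n) \<Rightarrow>
   ((real^'n) \<times> (real^'p) \<Rightarrow> real) \<Rightarrow> real \<Rightarrow> real \<Rightarrow> real \<Rightarrow> real \<Rightarrow> bool" where
  "lyapunov_function f h W \<alpha> \<beta> \<gamma> \<zeta> \<longleftrightarrow>
     0 < \<alpha> \<and> 0 < \<beta> \<and> 0 < \<gamma> \<and> 0 < \<zeta> \<and>
     (\<forall>z. W differentiable (at z)) \<and>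
     (\<forall>x u. \<alpha> * (norm (x - h u))\<^sup>2 \<le> W (x, u) \<and> W (x, u) \<le> \<beta> * (norm (x - h u))\<^sup>2) \<and>
     (\<forall>x u. fst (gradient W (x, u)) \<bullet> f (x, u) \<le> - \<gamma> * (norm (x - h u))\<^sup>2) \<and>
     (\<forall>x u. norm (snd (gradient W (x, u))) \<le> \<zeta> * norm (x - h u))"

text \<open>The product of the block matrix \<open>H(u)\<^sup>T = [\<nabla>h(u)\<^sup>T, I\<^sub>p]\<close> with the vector \<open>w\<close>.\<close>

definition HT_apply :: "(real^'p \<Rightarrow> real^'n) \<Rightarrow> real^'p \<Rightarrow> (real^'n) \<times> (real^'p) \<Rightarrow> real^'p" where
  "HT_apply h u w = transpose (jacobian h (at u)) *v fst w + snd w"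

definition critical_point ::
  "((real^'n) \<times> (real^'p) \<Rightarrow> real) \<Rightarrow> (real^'p \<Rightarrow> real^'n) \<Rightarrow> (real^'n) \<times> (real^'p) \<Rightarrow> bool" where
  "critical_point \<Phi> h = (\<lambda>(x, u).
     x = h u \<and>
     (\<exists>lam. gradient \<Phi> (x, u) + (lam, - (transpose (jacobian h (at u)) *v lam)) = 0))"

definition closed_loop ::
  "((real^'n) \<times> (real^'p) \<Rightarrow> real^'n) \<Rightarrow> (real^'p \<Rightarrow> real^'n) \<Rightarrow> ((real^'n) \<times> (real^'p) \<Rightarrow> real) \<Rightarrow>
   (real^'p \<Rightarrow> real^'p^'p) \<Rightarrow> (real^'p \<Rightarrow> real^'p^'p) \<Rightarrow>
   (real^'n) \<times> (real^'p) \<times> (real^'p) \<Rightarrow> (real^'n) \<times> (real^'p) \<times> (real^'p)" where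
  "closed_loop f h \<Phi> Q D = (\<lambda>(x, u, z).
     (f (x, u),
      Q u *v z,
      - (D u *v z) - Q u *v HT_apply h u (gradient \<Phi> (x, u))))"

end

theory Submission
  imports Defs "HOL-Complex_Analysis.Great_Picard"
begin

text \<open>
  Along the closed loop the reduced cost \<open>\<Phi> (h u, u)\<close> plus the kinetic energy \<open>\<bar>z\<bar>\<^sup>2 / 2\<close> would
  decrease if the plant were always at its steady state \<open>x = h u\<close>: the terms in which \<open>Q u\<close> couples
  \<open>u\<close> and \<open>z\<close> cancel, because \<open>Q u\<close> is symmetric, and only the damping \<open>- z \<bullet> D u z\<close> is left. Off
  steady state, an error of size at most \<open>L \<lambda>max(Q) \<bar>z\<bar> \<bar>x - h u\<bar>\<close> appears. The plant's own function
  \<open>W\<close> dissipates \<open>\<gamma> \<bar>x - h u\<bar>\<^sup>2\<close> up to an error \<open>\<zeta> \<lambda>max(Q) \<bar>z\<bar> \<bar>x - h u\<bar>\<close> due to the motion of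
  \<open>u\<close>. Adding \<open>W\<close> with weight \<open>L / \<zeta>\<close> makes the two errors equal, and the sum \<open>V\<close> satisfies
  \<open>V' \<le> 2 L \<lambda>max(Q) \<bar>z\<bar> \<bar>x - h u\<bar> - d \<bar>z\<bar>\<^sup>2 - (L \<gamma> / \<zeta>) \<bar>x - h u\<bar>\<^sup>2\<close>, where \<open>d\<close> is the infimum of the
  smallest eigenvalues of the damping. The gain condition says exactly that the discriminant of this
  quadratic form is negative when \<open>\<lambda>max(Q)\<close> is replaced by its supremum over \<open>u\<close>; hence
  \<open>V' \<le> - \<epsilon> (\<bar>z\<bar>\<^sup>2 + \<bar>x - h u\<bar>\<^sup>2)\<close> for some \<open>\<epsilon> > 0\<close> (\<open>V'_le_dissipation\<close>).

  The sublevel sets of \<open>V\<close> are bounded, because those of the reduced cost are compact and \<open>W\<close>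
  controls \<open>\<bar>x - h u\<bar>\<^sup>2\<close>. So trajectories are bounded. The right-hand side is merely continuous, and
  ruling out a finite lifetime therefore takes Peano's theorem: a bounded solution on \<open>[0, T)\<close> is
  Lipschitz, has a limit at \<open>T\<close>, and can be restarted there (\<open>bounded_trajectory_global\<close>).

  Without uniqueness of solutions there is no flow to which the usual form of LaSalle's principle
  would apply. Barbalat's lemma replaces it. Since \<open>V\<close> converges along a trajectory and its
  dissipation is uniformly continuous, \<open>z\<close> and \<open>x - h u\<close> tend to 0. Since \<open>z\<close> converges and its
  derivative is uniformly continuous, this derivative tends to 0 as well, and in the limit it is
  \<open>- Q u H(u)\<^sup>T \<nabla>\<Phi>\<close>. By compactness the trajectory approaches the common zero set of \<open>z\<close>, \<open>x - h u\<close>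
  and \<open>Q u H(u)\<^sup>T \<nabla>\<Phi>\<close>, which consists of the critical points with \<open>z = 0\<close>, as \<open>Q u\<close> is invertible.
\<close>

section \<open>Peano's existence theorem\<close>

lemma integral_lipschitz_on:
  fixes v :: "real \<Rightarrow> 'a::euclidean_space"
  assumes v: "continuous_on {0..} v" and M: "\<And>t. 0 \<le> t \<Longrightarrow> norm (v t) \<le> M"
  shows "M-lipschitz_on {0..} (\<lambda>t. c + integral {0..t} v)"
proof (rule lipschitz_onI)
  show "0 \<le> M"
    using M[of 0] norm_ge_zero[of "v 0"] by linarith
  have le: "dist (integral {0..s} v) (integral {0..t} v) \<le> M * dist s t" if "0 \<le> s" "s \<le> t" for s t
  proof -
    have "v integrable_on {0..t}"
      by (rule integrable_continuous_real[OF continuous_on_subset[OF v]]) auto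
    then have "integral {0..s} v + integral {s..t} v = integral {0..t} v"
      by (intro Henstock_Kurzweil_Integration.integral_combine that)
    then have "dist (integral {0..s} v) (integral {0..t} v) = norm (integral {s..t} v)"
      by (metis add_diff_cancel_left' dist_commute dist_norm)
    also have "\<dots> \<le> M * (t - s)"
      using that by (intro integral_bound M continuous_on_subset[OF v]) auto
    finally show ?thesis
      using that by (simp add: dist_real_def)
  qed
  fix s t :: real
  assume "s \<in> {0..}" "t \<in> {0..}"
  then show "dist (c + integral {0..s} v) (c + integral {0..t} v) \<le> M * dist s t"
    using le[of s t] le[of t s] by (cases "s \<le> t") (auto simp: dist_commute)
qed

text \<open>Tonelli's approximation: a delay \<open>d > 0\<close> makes the equation explicitly solvable. The value at \<open>t\<close>
  depends only on earlier values up to \<open>t - d\<close>, so the Picard iterates become stationary on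
  \<open>[0, k d]\<close> after \<open>k\<close> steps. The Lipschitz constant does not depend on \<open>d\<close>, which provides the
  equicontinuity for the limit \<open>d \<rightarrow> 0\<close>.\<close>

lemma delay_equation_solution:
  fixes G :: "'a::euclidean_space \<Rightarrow> 'a" and d r :: real
  assumes G: "continuous_on UNIV G" and M: "\<And>x. norm (G x) \<le> M" and d: "0 < d"
  shows "\<exists>x. M-lipschitz_on {0..} x \<and>
           (\<forall>t\<in>{0..r}. x t = x0 + integral {0..t} (\<lambda>s. G (x (max 0 (s - d)))))"
proof -
  define S where "S = (\<lambda>x t. x0 + integral {0..t} (\<lambda>s. G (x (max 0 (s - d)))))"
  define g where "g = (\<lambda>k. (S ^^ k) (\<lambda>_. x0))"
  have g_Suc: "g (Suc k) = S (g k)" for k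
    by (simp add: g_def)
  have S_lip: "M-lipschitz_on {0..} (S x)" if "continuous_on {0..} x" for x
    unfolding S_def
  proof (rule integral_lipschitz_on)
    show "continuous_on {0..} (\<lambda>s. G (x (max 0 (s - d))))"
      by (intro continuous_on_compose2[OF G] continuous_on_compose2[OF that] continuous_intros) auto
  qed (rule M)
  have g_cont: "continuous_on {0..} (g k)" for k
  proof (induction k)
    case 0
    then show ?case by (simp add: g_def)
  next
    case (Suc k)
    then show ?case
      using S_lip lipschitz_on_continuous_on unfolding g_Suc by blast
  qed
  have stationary: "\<forall>t\<in>{0..real k * d}. g (Suc k) t = g k t" for k
  proof (induction k)
    case 0
    then show ?case by (simp add: g_def S_def)
  next
    case (Suc k)
    show ?case
    proof
      fix t assume t: "t \<in> {0..real (Suc k) * d}"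
      have "g (Suc k) (max 0 (s - d)) = g k (max 0 (s - d))" if "s \<in> {0..t}" for s
      proof -
        have "s \<le> real k * d + d"
          using that t by (simp add: algebra_simps)
        then have "max 0 (s - d) \<in> {0..real k * d}"
          using d by auto
        then show ?thesis using Suc by blast
      qed
      then have "S (g (Suc k)) t = S (g k) t"
        unfolding S_def by (intro arg_cong[where f = "(+) x0"] integral_cong) simp
      then show "g (Suc (Suc k)) t = g (Suc k) t"
        unfolding g_Suc .
    qed
  qed
  obtain k :: nat where k: "r / d \<le> real k"
    using real_arch_simple by blast
  then have "r \<le> real k * d"
    using d by (simp add: field_simps)
  have "g (Suc k) t = S (g (Suc k)) t" if "t \<in> {0..r}" for t
  proof -
    have "t \<in> {0..real (Suc k) * d}"
      using that \<open>r \<le> real k * d\<close> d by (auto simp: algebra_simps)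
    then have "g (Suc (Suc k)) t = g (Suc k) t"
      using stationary[of "Suc k"] by blast
    then show ?thesis unfolding g_Suc[of "Suc k"] by simp
  qed
  moreover have "M-lipschitz_on {0..} (g (Suc k))"
    unfolding g_Suc by (rule S_lip[OF g_cont])
  ultimately show ?thesis
    unfolding S_def by blast
qed

text \<open>As the delay tends to 0, the approximants have a uniformly convergent subsequence by the
  Arzela-Ascoli theorem, and dominated convergence passes the delay equation to the limit.
  Boundedness of \<open>G\<close> keeps the approximants bounded on an interval of any length.\<close>

lemma peano_integral_equation:
  fixes G :: "'a::euclidean_space \<Rightarrow> 'a" and r :: real
  assumes G: "continuous_on UNIV G" and M: "\<And>x. norm (G x) \<le> M"
  shows "\<exists>w. continuous_on {0..r} w \<and> (\<forall>t\<in>{0..r}. w t = x0 + integral {0..t} (\<lambda>s. G (w s)))"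
proof -
  define d where "d = (\<lambda>n::nat. 1 / (real n + 1))"
  have d_pos: "0 < d n" for n by (simp add: d_def)
  have d_lim: "d \<longlonglongrightarrow> 0"
    unfolding d_def using LIMSEQ_inverse_real_of_nat
    by (simp add: inverse_eq_divide add.commute)
  have M0: "0 \<le> M"
    using M[of undefined] norm_ge_zero[of "G undefined"] by linarith
  have "\<forall>n. \<exists>x :: real \<Rightarrow> 'a. M-lipschitz_on {0..} x \<and>
           (\<forall>t\<in>{0..r}. x t = x0 + integral {0..t} (\<lambda>s. G (x (max 0 (s - d n)))))"
    using delay_equation_solution[OF G M d_pos] by blast
  then obtain x where x_lip: "\<And>n. M-lipschitz_on {0..} (x n)"
    and x_eq: "\<And>n t. t \<in> {0..r} \<Longrightarrow>
                 x n t = x0 + integral {0..t} (\<lambda>s. G (x n (max 0 (s - d n))))"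
    by metis
  have x_dist: "norm (x n s - x n t) \<le> M * \<bar>s - t\<bar>" if "0 \<le> s" "0 \<le> t" for n s t
    using lipschitz_onD[OF x_lip, of s t] that by (simp add: dist_norm)
  have x_bound: "norm (x n t) \<le> norm x0 + M * r" if t: "t \<in> {0..r}" for n t
  proof -
    have "x n 0 = x0"
      using x_eq[of 0 n] t by simp
    then have "norm (x n t) \<le> norm x0 + norm (x n t - x n 0)"
      by (metis add.commute diff_add_cancel norm_triangle_ineq)
    also have "\<dots> \<le> norm x0 + M * t"
      using x_dist[of t 0 n] t by simp
    also have "\<dots> \<le> norm x0 + M * r"
      using t M0 by (simp add: mult_left_mono)
    finally show ?thesis .
  qed
  have equicont: "\<exists>\<delta>. 0 < \<delta> \<and> (\<forall>n t. t \<in> {0..r} \<and> norm (s - t) < \<delta> \<longrightarrow> norm (x n s - x n t) < e)"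
    if s: "s \<in> {0..r}" and e: "0 < e" for s e
  proof (intro exI conjI allI impI)
    show "0 < e / (M + 1)" using e M0 by simp
    fix n t assume t: "t \<in> {0..r} \<and> norm (s - t) < e / (M + 1)"
    have "norm (x n s - x n t) \<le> M * \<bar>s - t\<bar>"
      using s t by (intro x_dist) auto
    also have "\<dots> \<le> (M + 1) * \<bar>s - t\<bar>" by (simp add: mult_right_mono)
    also have "\<dots> < e"
      using t M0 by (simp add: field_simps)
    finally show "norm (x n s - x n t) < e" .
  qed
  obtain w k where w: "continuous_on {0..r} w" and k: "strict_mono (k :: nat \<Rightarrow> nat)"
    and unif: "\<And>e. 0 < e \<Longrightarrow> \<exists>N. \<forall>n t. n \<ge> N \<and> t \<in> {0..r} \<longrightarrow> norm (x (k n) t - w t) < e"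
    using Arzela_Ascoli[of "{0..r}" x "norm x0 + M * r", OF compact_Icc x_bound equicont] by blast
  have conv: "(\<lambda>n. x (k n) t) \<longlonglongrightarrow> w t" if "t \<in> {0..r}" for t
    unfolding LIMSEQ_def dist_norm using unif that by blast
  have "w t = x0 + integral {0..t} (\<lambda>s. G (w s))" if t: "t \<in> {0..r}" for t
  proof -
    have G_conv: "(\<lambda>n. G (x (k n) (max 0 (s - d (k n))))) \<longlonglongrightarrow> G (w s)" if s: "s \<in> {0..t}" for s
    proof -
      have "(\<lambda>n. x (k n) (max 0 (s - d (k n))) - x (k n) s) \<longlonglongrightarrow> 0"
      proof (rule Lim_null_comparison)
        show "\<forall>\<^sub>F n in sequentially.
          norm (x (k n) (max 0 (s - d (k n))) - x (k n) s) \<le> M * d (k n)"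
        proof (intro always_eventually allI)
          fix n
          have "norm (x (k n) (max 0 (s - d (k n))) - x (k n) s)
                  \<le> M * \<bar>max 0 (s - d (k n)) - s\<bar>"
            using s by (intro x_dist) auto
          also have "\<dots> \<le> M * d (k n)"
            using s d_pos[of "k n"] M0 by (intro mult_left_mono) auto
          finally show "norm (x (k n) (max 0 (s - d (k n))) - x (k n) s) \<le> M * d (k n)" .
        qed
        show "(\<lambda>n. M * d (k n)) \<longlonglongrightarrow> 0"
          using tendsto_mult_left[OF LIMSEQ_subseq_LIMSEQ[OF d_lim k], of M]
          by (simp add: o_def)
      qed
      from tendsto_add[OF this conv[of s]] s t
      have "(\<lambda>n. x (k n) (max 0 (s - d (k n)))) \<longlonglongrightarrow> w s" by simp
      then show ?thesis
        using G by (intro isCont_tendsto_compose[of _ G]) (simp add: continuous_on_eq_continuous_at)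
    qed
    have int: "(\<lambda>s. G (x (k n) (max 0 (s - d (k n))))) integrable_on {0..t}" for n
      by (intro integrable_continuous_real continuous_on_compose2[OF G]
          continuous_on_compose2[OF lipschitz_on_continuous_on[OF x_lip]] continuous_intros) auto
    have "(\<lambda>n. integral {0..t} (\<lambda>s. G (x (k n) (max 0 (s - d (k n)))))) \<longlonglongrightarrow>
            integral {0..t} (\<lambda>s. G (w s))"
      by (rule dominated_convergence(2)[where h = "\<lambda>_. M", OF int]) (use M G_conv in auto)
    then have "(\<lambda>n. x (k n) t) \<longlonglongrightarrow> x0 + integral {0..t} (\<lambda>s. G (w s))"
      using x_eq[OF t] by (simp add: tendsto_add)
    then show ?thesis
      using conv[OF t] LIMSEQ_unique by blast
  qed
  with w show ?thesis by blast
qed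

text \<open>Projecting onto a ball around \<open>x0\<close> before applying \<open>F\<close> gives a bounded vector field. Its solution
  stays in the ball for a short time, during which it solves the original equation.\<close>

theorem peano_existence:
  fixes F :: "'a::euclidean_space \<Rightarrow> 'a"
  assumes F: "continuous_on UNIV F"
  shows "\<exists>r>0. \<exists>w. w 0 = x0 \<and> solves_on {0..r} F w"
proof -
  define P where "P = closest_point (cball x0 1)"
  have P_in: "P x \<in> cball x0 1" for x
    unfolding P_def by (rule closest_point_in_set) auto
  have P_id: "P x = x" if "x \<in> cball x0 1" for x
    unfolding P_def using that by (rule closest_point_self)
  have P_cont: "continuous_on UNIV P"
    unfolding P_def by (rule continuous_on_closest_point) auto
  have "bounded (F ` cball x0 1)"
    by (intro compact_imp_bounded compact_continuous_image continuous_on_subset[OF F]) auto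
  then obtain M where M: "\<And>x. x \<in> cball x0 1 \<Longrightarrow> norm (F x) \<le> M"
    unfolding bounded_iff by blast
  \<comment> \<open>At speed at most \<open>\<bar>M\<bar>\<close> the unit ball cannot be left before time \<open>r\<close>.\<close>
  define r where "r = 1 / (\<bar>M\<bar> + 1)"
  have "r > 0" by (simp add: r_def)
  have FP: "continuous_on UNIV (\<lambda>x. F (P x))"
    by (intro continuous_on_compose2[OF F P_cont]) auto
  obtain w where w_cont: "continuous_on {0..r} w"
    and w_eq: "\<And>t. t \<in> {0..r} \<Longrightarrow> w t = x0 + integral {0..t} (\<lambda>s. F (P (w s)))"
    using peano_integral_equation[OF FP M[OF P_in]] by blast
  have v_cont: "continuous_on {0..r} (\<lambda>s. F (P (w s)))"
    by (intro continuous_on_compose2[OF FP w_cont]) auto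
  have in_ball: "w t \<in> cball x0 1" if t: "t \<in> {0..r}" for t
  proof -
    have "norm (integral {0..t} (\<lambda>s. F (P (w s)))) \<le> \<bar>M\<bar> * (t - 0)"
    proof (rule integral_bound)
      show "continuous_on {0..t} (\<lambda>s. F (P (w s)))"
        using t by (intro continuous_on_subset[OF v_cont]) auto
      show "norm (F (P (w s))) \<le> \<bar>M\<bar>" for s
        using M[OF P_in, of "w s"] by linarith
    qed (use t in auto)
    also have "\<dots> \<le> \<bar>M\<bar> * r" using t by (simp add: mult_left_mono)
    also have "\<dots> \<le> 1" by (simp add: r_def field_simps)
    finally show ?thesis using w_eq[OF t] by (simp add: dist_norm)
  qed
  have "(w has_vector_derivative F (w t)) (at t within {0..r})" if t: "t \<in> {0..r}" for t
  proof (rule has_vector_derivative_transform[OF t])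
    have "((\<lambda>u. integral {0..u} (\<lambda>s. F (P (w s)))) has_vector_derivative F (P (w t)))
        (at t within {0..r})"
      by (rule integral_has_vector_derivative[OF v_cont t])
    then show "((\<lambda>u. x0 + integral {0..u} (\<lambda>s. F (P (w s)))) has_vector_derivative F (w t))
        (at t within {0..r})"
      unfolding P_id[OF in_ball[OF t]]
      using has_vector_derivative_add[OF has_vector_derivative_const] by force
    show "w u = x0 + integral {0..u} (\<lambda>s. F (P (w s)))" if "u \<in> {0..r}" for u
      using w_eq[OF that] .
  qed
  moreover have "w 0 = x0"
    using w_eq[of 0] \<open>r > 0\<close> by simp
  ultimately show ?thesis
    using \<open>r > 0\<close> unfolding solves_on_def by blast
qed

section \<open>Bounded trajectories are global\<close>

lemma solves_on_subset: "solves_on I F y \<Longrightarrow> J \<subseteq> I \<Longrightarrow> solves_on J F y"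
  unfolding solves_on_def using has_vector_derivative_within_subset by blast

lemma solution_lipschitz_on:
  fixes F :: "'a::euclidean_space \<Rightarrow> 'a"
  assumes sol: "solves_on I F y" and I: "convex I"
    and F: "continuous_on UNIV F" and bdd: "bounded (y ` I)"
  shows "\<exists>C. C-lipschitz_on I y"
proof -
  have "compact (F ` closure (y ` I))"
    using bdd by (intro compact_continuous_image continuous_on_subset[OF F]) auto
  then obtain M where "\<forall>v\<in>F ` closure (y ` I). norm v \<le> M"
    using compact_imp_bounded bounded_iff by metis
  then have M: "norm (F (y t)) \<le> M" if "t \<in> I" for t
    using that closure_subset[of "y ` I"] by blast
  have "\<bar>M\<bar>-lipschitz_on I y"
  proof (rule lipschitz_onI)
    fix s t assume "s \<in> I" "t \<in> I"
    then show "dist (y s) (y t) \<le> \<bar>M\<bar> * dist s t"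
      unfolding dist_norm
    proof (rule differentiable_bound[OF I, rotated 2])
      fix t assume t: "t \<in> I"
      then show "(y has_derivative (\<lambda>h. h *\<^sub>R F (y t))) (at t within I)"
        using sol unfolding solves_on_def has_vector_derivative_def by blast
      show "onorm (\<lambda>h. h *\<^sub>R F (y t)) \<le> \<bar>M\<bar>"
      proof (rule onorm_bound)
        show "norm (h *\<^sub>R F (y t)) \<le> \<bar>M\<bar> * norm h" for h
          using M[OF t] mult_right_mono[of "norm (F (y t))" "\<bar>M\<bar>" "\<bar>h\<bar>"]
          by (simp add: mult.commute)
      qed simp
    qed
  qed simp
  then show ?thesis by blast
qed

text \<open>If the lifetime \<open>b\<close> were finite, the solution would be Lipschitz and hence extend continuously to
  the closed interval, where it still solves the equation (through its integral form, which passes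
  to the endpoint). A Peano solution started at the endpoint then continues it.\<close>

lemma bounded_trajectory_global:
  fixes F :: "'a::euclidean_space \<Rightarrow> 'a"
  assumes F: "continuous_on UNIV F" and traj: "trajectory F T y"
    and bdd: "bounded (y ` time_interval T)"
  shows "T = \<infinity>"
proof (rule ccontr)
  assume "T \<noteq> \<infinity>"
  with traj obtain b where T: "T = ereal b" and b: "0 < b"
    unfolding trajectory_def by (cases T) auto
  have I: "time_interval T = {0..<b}"
    by (auto simp: time_interval_def T)
  from traj have sol: "solves_on {0..<b} F y"
    unfolding trajectory_def I by blast
  obtain C where "C-lipschitz_on {0..<b} y"
    using solution_lipschitz_on[OF sol _ F] bdd unfolding I by auto
  then obtain g where g_lip: "C-lipschitz_on (closure {0..<b}) g"
    and g_y: "\<And>t. t \<in> {0..<b} \<Longrightarrow> g t = y t"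
    using lipschitz_extend_closure by blast
  have g_cont: "continuous_on {0..b} g"
    using lipschitz_on_continuous_on[OF g_lip] b by simp
  have Fg_cont: "continuous_on {0..b} (\<lambda>s. F (g s))"
    by (rule continuous_on_compose2[OF F g_cont]) auto
  have g_eq: "g t = g 0 + integral {0..t} (\<lambda>s. F (g s))" if t: "t \<in> {0..b}" for t
  proof -
    have "((\<lambda>s. F (g s)) has_integral (g t - g 0)) {0..t}"
    proof (rule fundamental_theorem_of_calculus_interior)
      show "continuous_on {0..t} g"
        using t by (intro continuous_on_subset[OF g_cont]) auto
      fix s assume s: "s \<in> {0<..<t}"
      have "(g has_vector_derivative F (g s)) (at s within {0..<b})"
        using sol s t g_y unfolding solves_on_def
        by (intro has_vector_derivative_transform[of s "{0..<b}" g y]) auto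
      then show "(g has_vector_derivative F (g s)) (at s)"
        using at_within_interior[of s "{0..<b}"] s t by simp
    qed (use t in auto)
    then show ?thesis by (simp add: integral_unique)
  qed
  have g_sol: "(g has_vector_derivative F (g t)) (at t within {0..b})" if t: "t \<in> {0..b}" for t
  proof (rule has_vector_derivative_transform[OF t g_eq])
    show "((\<lambda>t. g 0 + integral {0..t} (\<lambda>s. F (g s))) has_vector_derivative F (g t))
        (at t within {0..b})"
      using has_vector_derivative_add[OF has_vector_derivative_const
          integral_has_vector_derivative[OF Fg_cont t]] by force
  qed
  obtain r w where r: "0 < r" and w0: "w 0 = g b" and w_sol: "solves_on {0..r} F w"
    using peano_existence[OF F] by blast
  have shift: "((\<lambda>t. w (t - b)) has_vector_derivative F (w (t - b))) (at t within {b..b + r})"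
    if t: "t \<in> {b..b + r}" for t
  proof -
    have "((w \<circ> (\<lambda>t. t - b)) has_vector_derivative 1 *\<^sub>R F (w (t - b))) (at t within {b..b + r})"
    proof (rule vector_diff_chain_within)
      show "((\<lambda>t. t - b) has_vector_derivative 1) (at t within {b..b + r})"
        by (auto intro!: derivative_eq_intros)
      have "(w has_vector_derivative F (w (t - b))) (at (t - b) within {0..r})"
        using w_sol t unfolding solves_on_def by auto
      then show "(w has_vector_derivative F (w (t - b))) (at (t - b) within (\<lambda>t. t - b) ` {b..b + r})"
        by (rule has_vector_derivative_within_subset) auto
    qed
    then show ?thesis by (simp add: o_def)
  qed
  define Y where "Y = (\<lambda>t. if t \<in> {0..b} then g t else w (t - b))"
  have Y_deriv: "(Y has_vector_derivative
      (if t \<in> {0..b} then F (g t) else F (w (t - b)))) (at t within {0..b + r})"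
    if t: "t \<in> {0..b + r}" for t
    unfolding Y_def
  proof (rule has_vector_derivative_If_within_closures[where T = "{b..b + r}"])
    show "(g has_vector_derivative F (g t))
       (at t within {0..b} \<union> (closure {0..b} \<inter> closure {b..b + r}))"
      if "t \<in> {0..b} \<union> (closure {0..b} \<inter> closure {b..b + r})"
    proof -
      have "{0..b} \<union> (closure {0..b} \<inter> closure {b..b + r}) = {0..b}" by auto
      with that g_sol show ?thesis by auto
    qed
    show "((\<lambda>t. w (t - b)) has_vector_derivative F (w (t - b)))
       (at t within {b..b + r} \<union> (closure {0..b} \<inter> closure {b..b + r}))"
      if "t \<in> {b..b + r} \<union> (closure {0..b} \<inter> closure {b..b + r})"
    proof -
      have "{b..b + r} \<union> (closure {0..b} \<inter> closure {b..b + r}) = {b..b + r}"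
        using r b by auto
      with that shift show ?thesis by auto
    qed
  qed (use t b r w0 in auto)
  have "solves_on {0..b + r} F Y"
    unfolding solves_on_def
  proof
    fix t assume t: "t \<in> {0..b + r}"
    have "F (Y t) = (if t \<in> {0..b} then F (g t) else F (w (t - b)))"
      by (simp add: Y_def)
    with Y_deriv[OF t] show "(Y has_vector_derivative F (Y t)) (at t within {0..b + r})"
      by simp
  qed
  then have "solves_on (time_interval (ereal (b + r))) F Y"
    by (rule solves_on_subset) (auto simp: time_interval_def)
  moreover have "\<forall>t\<in>time_interval T. Y t = y t"
    unfolding I Y_def using g_y by auto
  moreover have "T < ereal (b + r)"
    using r by (simp add: T)
  ultimately show False
    using traj unfolding trajectory_def by blast
qed

section \<open>Barbalat's lemma and convergence to a zero set\<close>

lemma decrease_at_rate: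
  fixes V :: "real \<Rightarrow> real"
  assumes "a \<le> b"
    and V: "\<And>t. t \<in> {a..b} \<Longrightarrow> (V has_real_derivative V' t) (at t within {a..b})"
    and le: "\<And>t. t \<in> {a..b} \<Longrightarrow> V' t \<le> - c"
  shows "V b \<le> V a - c * (b - a)"
proof (cases "a = b")
  case False
  with \<open>a \<le> b\<close> have "a < b" by simp
  have "\<exists>t\<in>{a<..<b}. V b - V a = V' t * (b - a)"
    using V \<open>a < b\<close> by (intro mvt_simple) (auto simp: has_field_derivative_def)
  then obtain t where t: "t \<in> {a<..<b}" and "V b - V a = V' t * (b - a)"
    by blast
  moreover have "V' t * (b - a) \<le> - c * (b - a)"
    using le[of t] t \<open>a < b\<close> by (intro mult_right_mono) auto
  ultimately show ?thesis by simp
qed simp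

text \<open>Wherever \<open>\<phi>\<close> reaches \<open>e\<close> it stays above \<open>e / 2\<close> on an interval of fixed length, by uniform
  continuity. So \<open>V\<close> loses a fixed amount there, which a convergent function can do only finitely
  often. The function \<open>\<phi>\<close> may change sign, so that the lemma also applies to derivatives.\<close>

lemma barbalat:
  fixes V \<phi> :: "real \<Rightarrow> real"
  assumes V: "\<And>t. 0 \<le> t \<Longrightarrow> (V has_real_derivative V' t) (at t within {0..})"
    and le: "\<And>t. 0 \<le> t \<Longrightarrow> V' t \<le> - \<phi> t"
    and \<phi>: "uniformly_continuous_on {0..} \<phi>"
    and lim: "(V \<longlongrightarrow> v) at_top" and e: "0 < e"
  shows "\<forall>\<^sub>F t in at_top. \<phi> t < e"
proof -
  obtain \<delta> where \<delta>: "0 < \<delta>"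
    and close: "\<And>s t. 0 \<le> s \<Longrightarrow> 0 \<le> t \<Longrightarrow> dist s t < \<delta> \<Longrightarrow> dist (\<phi> s) (\<phi> t) < e / 2"
    using \<phi> e unfolding uniformly_continuous_on_def by (metis atLeast_iff half_gt_zero)
  define d where "d = \<delta> / 2"
  have d: "0 < d" "d < \<delta>" using \<delta> by (auto simp: d_def)
  have "\<forall>\<^sub>F t in at_top. dist (V t) v < e * d / 8"
    using lim e d by (intro tendstoD) auto
  then obtain N where N: "\<And>t. N \<le> t \<Longrightarrow> dist (V t) v < e * d / 8"
    unfolding eventually_at_top_linorder by blast
  have "\<phi> t < e" if t: "max 0 N \<le> t" for t
  proof (rule ccontr)
    assume "\<not> \<phi> t < e"
    have "V (t + d) \<le> V t - (e / 2) * (t + d - t)"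
    proof (rule decrease_at_rate)
      fix s assume s: "s \<in> {t..t + d}"
      show "(V has_real_derivative V' s) (at s within {t..t + d})"
        using s t by (intro has_field_derivative_subset[OF V]) auto
      have "dist (\<phi> s) (\<phi> t) < e / 2"
        using s t d by (intro close) (auto simp: dist_real_def)
      with \<open>\<not> \<phi> t < e\<close> have "e / 2 \<le> \<phi> s"
        unfolding dist_real_def by linarith
      with le[of s] s t show "V' s \<le> - (e / 2)" by auto
    qed (use d in auto)
    moreover have "dist (V t) v < e * d / 8" "dist (V (t + d)) v < e * d / 8"
      using t d N[of t] N[of "t + d"] by auto
    ultimately show False
      unfolding dist_real_def abs_less_iff by (simp add: field_simps)
  qed
  then show ?thesis unfolding eventually_at_top_linorder by blast
qed

text \<open>In each coordinate, this is the previous lemma applied with \<open>\<phi>\<close> equal to plus and minus the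
  derivative.\<close>

lemma barbalat_derivative:
  fixes z :: "real \<Rightarrow> 'b::euclidean_space"
  assumes z: "\<And>t. 0 \<le> t \<Longrightarrow> (z has_vector_derivative z' t) (at t within {0..})"
    and z': "uniformly_continuous_on {0..} z'" and lim: "(z \<longlongrightarrow> a) at_top"
  shows "(z' \<longlongrightarrow> 0) at_top"
  unfolding tendsto_componentwise_iff[of z']
proof
  fix i :: 'b assume i: "i \<in> Basis"
  have deriv: "((\<lambda>t. z t \<bullet> b) has_real_derivative z' t \<bullet> b) (at t within {0..})" if "0 \<le> t" for t b
    using bounded_linear.has_vector_derivative[OF bounded_linear_inner_left z[OF that]]
    by (simp add: has_real_derivative_iff_has_vector_derivative)
  have unif: "uniformly_continuous_on {0..} (\<lambda>t. z' t \<bullet> b)" for b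
    using bounded_linear.uniformly_continuous_on[OF bounded_linear_inner_left z'] .
  show "((\<lambda>t. z' t \<bullet> i) \<longlongrightarrow> 0 \<bullet> i) at_top"
  proof (rule tendstoI)
    fix e :: real assume e: "0 < e"
    have "\<forall>\<^sub>F t in at_top. z' t \<bullet> (- i) < e"
      by (rule barbalat[where V = "\<lambda>t. z t \<bullet> i" and V' = "\<lambda>t. z' t \<bullet> i", OF deriv _ unif _ e])
        (auto intro!: tendsto_intros lim)
    moreover have "\<forall>\<^sub>F t in at_top. z' t \<bullet> i < e"
      by (rule barbalat[where V = "\<lambda>t. z t \<bullet> (- i)" and V' = "\<lambda>t. z' t \<bullet> (- i)",
            OF deriv _ unif _ e])
        (auto intro!: tendsto_intros lim simp del: inner_minus_right, simp)
    ultimately show "\<forall>\<^sub>F t in at_top. dist (z' t \<bullet> i) (0 \<bullet> i) < e"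
      by eventually_elim (auto simp: dist_real_def)
  qed
qed

lemma uniformly_continuous_on_compose_bounded:
  fixes G :: "'a::heine_borel \<Rightarrow> 'b::metric_space" and y :: "'c::metric_space \<Rightarrow> 'a"
  assumes G: "continuous_on UNIV G" and bdd: "bounded (y ` I)"
    and y: "uniformly_continuous_on I y"
  shows "uniformly_continuous_on I (\<lambda>t. G (y t))"
proof (rule uniformly_continuous_on_compose[OF y, unfolded o_def])
  have "uniformly_continuous_on (closure (y ` I)) G"
    using bdd by (intro compact_uniformly_continuous continuous_on_subset[OF G]) auto
  then show "uniformly_continuous_on (y ` I) G"
    unfolding uniformly_continuous_on_def using subsetD[OF closure_subset[of "y ` I"]]
    by (metis (no_types, lifting))
qed

lemma antitone_bounded_below_converges:
  fixes v :: "real \<Rightarrow> real"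
  assumes anti: "\<And>s t. 0 \<le> s \<Longrightarrow> s \<le> t \<Longrightarrow> v t \<le> v s" and lb: "\<And>t. 0 \<le> t \<Longrightarrow> m \<le> v t"
  shows "\<exists>l. (v \<longlongrightarrow> l) at_top"
proof
  define l where "l = Inf (v ` {0..})"
  have bdd: "bdd_below (v ` {0..})" using lb by (auto intro!: bdd_belowI[of _ m])
  show "(v \<longlongrightarrow> l) at_top"
  proof (rule tendstoI)
    fix e :: real assume e: "0 < e"
    have "Inf (v ` {0..}) < l + e" using e by (simp add: l_def)
    then obtain s where s: "0 \<le> s" "v s < l + e"
      using cInf_lessD[of "v ` {0..}" "l + e"] by auto
    have "dist (v t) l < e" if t: "s \<le> t" for t
    proof -
      have "l \<le> v t" unfolding l_def using s t by (intro cInf_lower bdd) auto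
      moreover have "v t \<le> v s" using s(1) t by (rule anti)
      ultimately show ?thesis using s(2) by (simp add: dist_real_def)
    qed
    then show "\<forall>\<^sub>F t in at_top. dist (v t) l < e"
      unfolding eventually_at_top_linorder by blast
  qed
qed

text \<open>On the part of the orbit closure at distance at least \<open>e\<close> from the zero set, a compact set, \<open>norm N\<close>
  has a positive minimum; so the orbit eventually avoids it. If the zero set were empty, this part
  would be the whole orbit closure, which the orbit cannot avoid.\<close>

lemma converges_to_zero_set:
  fixes y :: "real \<Rightarrow> 'a::heine_borel" and N :: "'a \<Rightarrow> 'b::real_normed_vector"
  assumes bdd: "bounded (y ` {0..})" and N: "continuous_on UNIV N"
    and lim: "((\<lambda>t. N (y t)) \<longlongrightarrow> 0) at_top"
  shows "converges_to_set y {s. N s = 0}"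
  unfolding converges_to_set_def
proof (intro allI impI)
  fix e :: real assume e: "0 < e"
  define U where "U = (\<Union>s\<in>{s. N s = 0}. ball s e)"
  define K where "K = closure (y ` {0..}) - U"
  have K: "compact K"
    unfolding K_def U_def using bdd by (intro compact_diff) auto
  have nz: "N s \<noteq> 0" if "s \<in> K" for s
    using that e unfolding K_def U_def by force
  obtain m where m: "0 < m" "\<And>s. s \<in> K \<Longrightarrow> m \<le> norm (N s)"
  proof (cases "K = {}")
    case True
    then show ?thesis using that[of 1] by simp
  next
    case False
    have "continuous_on K (\<lambda>s. norm (N s))"
      by (intro continuous_on_norm continuous_on_subset[OF N]) auto
    then obtain s where "s \<in> K" "\<And>t. t \<in> K \<Longrightarrow> norm (N s) \<le> norm (N t)"
      using continuous_attains_inf[OF K False] by blast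
    then show ?thesis using that[of "norm (N s)"] nz by auto
  qed
  have "\<forall>\<^sub>F t in at_top. dist (N (y t)) 0 < m"
    using lim m(1) by (rule tendstoD)
  with eventually_ge_at_top[of 0]
  show "\<forall>\<^sub>F t in at_top. \<exists>s\<in>{s. N s = 0}. dist (y t) s < e"
  proof eventually_elim
    case (elim t)
    have "y t \<notin> K"
      using m(2)[of "y t"] elim by auto
    moreover have "y t \<in> closure (y ` {0..})"
      using elim closure_subset by fastforce
    ultimately have "y t \<in> U" unfolding K_def by blast
    then show ?case
      unfolding U_def by (auto simp: dist_commute)
  qed
qed

section \<open>Extremal eigenvalues of symmetric matrices\<close>

lemma inner_matrix_swap: "x \<bullet> (A *v y) = (transpose A *v x) \<bullet> (y :: real^'n)"
  by (simp add: dot_lmul_matrix[symmetric] transpose_matrix_vector)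

lemma symmetric_form_add:
  fixes A :: "real^'n^'n"
  assumes "transpose A = A"
  shows "(v + s *\<^sub>R w) \<bullet> (A *v (v + s *\<^sub>R w))
           = v \<bullet> (A *v v) + 2 * s * (w \<bullet> (A *v v)) + s\<^sup>2 * (w \<bullet> (A *v w))"
proof -
  have "v \<bullet> (A *v w) = w \<bullet> (A *v v)"
    using inner_matrix_swap[of v A w] assms by (simp add: inner_commute)
  then show ?thesis
    by (simp add: matrix_vector_right_distrib matrix_vector_mult_scaleR inner_add_left
        inner_add_right power2_eq_square algebra_simps)
qed

text \<open>The nonnegative function \<open>t \<mapsto> (v + t w) \<bullet> B (v + t w)\<close> vanishes at 0, so its derivative
  \<open>2 w \<bullet> B v\<close> there is 0; take \<open>w = B v\<close>.\<close>

lemma psd_form_zero_imp_kernel: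
  fixes B :: "real^'n^'n"
  assumes sym: "transpose B = B" and psd: "\<And>v. 0 \<le> v \<bullet> (B *v v)" and z: "v \<bullet> (B *v v) = 0"
  shows "B *v v = 0"
proof -
  define w where "w = B *v v"
  define n where "n = w \<bullet> w"
  define c where "c = w \<bullet> (B *v w)"
  have c: "0 \<le> c" unfolding c_def by (rule psd)
  \<comment> \<open>The form at \<open>v + t w\<close> is \<open>2 t n + t\<^sup>2 c\<close>; at \<open>t = - n / (c + 1)\<close> it is negative unless \<open>n = 0\<close>.\<close>
  have "0 \<le> 2 * (- n / (c + 1)) * n + (- n / (c + 1))\<^sup>2 * c"
    using psd[of "v + (- n / (c + 1)) *\<^sub>R w"]
    unfolding symmetric_form_add[OF sym] z by (simp add: w_def n_def c_def)
  also have "\<dots> = - (n\<^sup>2 * (c + 2) / (c + 1)\<^sup>2)"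
  proof -
    have "(c + 1) * (c + 1) \<noteq> 0" using c by simp
    then show ?thesis
      by (simp add: divide_simps power2_eq_square) (simp add: algebra_simps)
  qed
  finally have "n\<^sup>2 * (c + 2) / (c + 1)\<^sup>2 \<le> 0" by simp
  then have "n\<^sup>2 \<le> 0"
    using c by (simp add: divide_le_0_iff mult_le_0_iff)
  then show ?thesis by (simp add: n_def w_def)
qed

text \<open>Eigenvectors for distinct eigenvalues are orthogonal, hence linearly independent. Finiteness
  gives the \<open>Min\<close> and \<open>Max\<close> in the definitions of the extremal eigenvalues their meaning.\<close>

lemma finite_eigenvalues:
  fixes A :: "real^'n^'n"
  assumes sym: "transpose A = A"
  shows "finite (eigenvalues A)"
proof -
  obtain v where v: "\<And>c. c \<in> eigenvalues A \<Longrightarrow> v c \<noteq> 0 \<and> A *v v c = c *\<^sub>R v c"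
  proof -
    have "\<forall>c\<in>eigenvalues A. \<exists>v. v \<noteq> 0 \<and> A *v v = c *\<^sub>R v"
      by (simp add: eigenvalues_def)
    from bchoice[OF this] show ?thesis using that by blast
  qed
  have orth: "v c \<bullet> v d = 0" if "c \<in> eigenvalues A" "d \<in> eigenvalues A" "c \<noteq> d" for c d
  proof -
    have "d * (v c \<bullet> v d) = c * (v c \<bullet> v d)"
      using inner_matrix_swap[of "v c" A "v d"] v[OF that(1)] v[OF that(2)] sym by simp
    then show ?thesis using that(3) by simp
  qed
  have "inj_on v (eigenvalues A)"
    using orth v by (intro inj_onI) (metis inner_eq_zero_iff)
  moreover have "independent (v ` eigenvalues A)"
    using orth v by (intro pairwise_orthogonal_independent) (auto simp: pairwise_def orthogonal_def)
  then have "finite (v ` eigenvalues A)"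
    by (rule independent_imp_finite)
  ultimately show ?thesis
    using finite_imageD by blast
qed

text \<open>The minimum \<open>m\<close> of the Rayleigh quotient, attained on the unit sphere at some \<open>x\<close>, makes
  \<open>A - m I\<close> positive semidefinite with a zero of its form at \<open>x\<close>; so \<open>x\<close> is an eigenvector.\<close>

lemma minimal_eigenvalue_exists:
  fixes A :: "real^'n^'n"
  assumes sym: "transpose A = A"
  shows "\<exists>m\<in>eigenvalues A. \<forall>v. m * (v \<bullet> v) \<le> v \<bullet> (A *v v)"
proof -
  let ?S = "sphere (0 :: real^'n) 1"
  have "continuous_on ?S (\<lambda>v. v \<bullet> (A *v v))"
    by (intro continuous_intros)
  moreover have "axis undefined 1 \<in> ?S" by simp
  ultimately obtain x where x: "x \<in> ?S" and min: "\<And>v. v \<in> ?S \<Longrightarrow> x \<bullet> (A *v x) \<le> v \<bullet> (A *v v)"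
    using continuous_attains_inf[of ?S "\<lambda>v. v \<bullet> (A *v v)"] by (metis compact_sphere empty_iff)
  define m where "m = x \<bullet> (A *v x)"
  have form: "m * (v \<bullet> v) \<le> v \<bullet> (A *v v)" for v
  proof (cases "v = 0")
    case False
    then have "m \<le> (v /\<^sub>R norm v) \<bullet> (A *v (v /\<^sub>R norm v))"
      unfolding m_def by (intro min) simp
    with False show ?thesis
      by (simp add: matrix_vector_mult_scaleR dot_square_norm power2_eq_square field_simps)
  qed simp
  define B where "B = A - m *\<^sub>R mat 1"
  have B: "B *v v = A *v v - m *\<^sub>R v" for v
    unfolding B_def by (simp add: matrix_vector_mult_diff_rdistrib scaleR_matrix_vector_assoc[symmetric])
  have "transpose B = B"
    using sym by (auto simp: B_def transpose_def mat_def vec_eq_iff)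
  moreover have "0 \<le> v \<bullet> (B *v v)" for v
    using form by (simp add: B inner_diff_right)
  moreover have "x \<bullet> (B *v x) = 0"
    using x by (simp add: B inner_diff_right m_def dot_square_norm)
  ultimately have "B *v x = 0"
    by (rule psd_form_zero_imp_kernel)
  then have "A *v x = m *\<^sub>R x" by (simp add: B)
  moreover have "x \<noteq> 0" using x by auto
  ultimately have "m \<in> eigenvalues A" unfolding eigenvalues_def by blast
  with form show ?thesis by blast
qed

lemma lambda_min_form_le:
  fixes A :: "real^'n^'n"
  assumes sym: "transpose A = A"
  shows "lambda_min A * (v \<bullet> v) \<le> v \<bullet> (A *v v)"
proof -
  obtain m where m: "m \<in> eigenvalues A" and form: "m * (v \<bullet> v) \<le> v \<bullet> (A *v v)"
    using minimal_eigenvalue_exists[OF sym] by blast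
  have "lambda_min A \<le> m"
    unfolding lambda_min_def by (rule Min_le[OF finite_eigenvalues[OF sym] m])
  then have "lambda_min A * (v \<bullet> v) \<le> m * (v \<bullet> v)"
    by (rule mult_right_mono) simp
  with form show ?thesis by linarith
qed

lemma form_le_lambda_max:
  fixes A :: "real^'n^'n"
  assumes sym: "transpose A = A"
  shows "v \<bullet> (A *v v) \<le> lambda_max A * (v \<bullet> v)"
proof -
  have neg: "(- A) *v w = - (A *v w)" for w
    by (simp add: matrix_vector_mult_def vec_eq_iff sum_negf)
  have "transpose (- A) = - A"
    using sym by (simp add: transpose_def vec_eq_iff)
  then obtain m where m: "m \<in> eigenvalues (- A)" and form: "m * (v \<bullet> v) \<le> v \<bullet> ((- A) *v v)"
    using minimal_eigenvalue_exists by blast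
  from m have "- m \<in> eigenvalues A"
    unfolding eigenvalues_def neg mem_Collect_eq by (metis minus_equation_iff scaleR_minus_left)
  then have "- m \<le> lambda_max A"
    unfolding lambda_max_def by (rule Max_ge[OF finite_eigenvalues[OF sym]])
  then have "- m * (v \<bullet> v) \<le> lambda_max A * (v \<bullet> v)"
    by (rule mult_right_mono) simp
  with form show ?thesis by (simp add: neg)
qed

lemma pos_def_symmetric: "A \<in> pos_def_matrices \<Longrightarrow> transpose A = A"
  and pos_def_form_pos: "A \<in> pos_def_matrices \<Longrightarrow> v \<noteq> 0 \<Longrightarrow> 0 < v \<bullet> (A *v v)"
  by (auto simp: pos_def_matrices_def)

lemma pos_def_kernel: "A \<in> pos_def_matrices \<Longrightarrow> A *v v = 0 \<longleftrightarrow> v = 0"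
  using pos_def_form_pos[of A v] by fastforce

lemma lambda_max_pos:
  fixes A :: "real^'n^'n"
  assumes A: "A \<in> pos_def_matrices"
  shows "0 < lambda_max A"
proof -
  define e :: "real^'n" where "e = axis undefined 1"
  have "e \<noteq> 0" and "e \<bullet> e = 1" by (simp_all add: e_def axis_eq_0_iff inner_axis_axis)
  then show ?thesis
    using form_le_lambda_max[OF pos_def_symmetric[OF A], of e] pos_def_form_pos[OF A, of e] by simp
qed

text \<open>Positivity of the form at \<open>v - A v / \<lambda>\<close>, with \<open>\<lambda>\<close> the largest eigenvalue, gives
  \<open>\<bar>A v\<bar>\<^sup>2 \<le> \<lambda> (v \<bullet> A v)\<close>; this avoids diagonalizing \<open>A\<close>.\<close>

lemma norm_pos_def_le_lambda_max:
  fixes A :: "real^'n^'n"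
  assumes A: "A \<in> pos_def_matrices"
  shows "norm (A *v v) \<le> lambda_max A * norm v"
proof -
  define q where "q = lambda_max A"
  define w where "w = A *v v"
  note sym = pos_def_symmetric[OF A]
  have q: "0 < q" unfolding q_def by (rule lambda_max_pos[OF A])
  have "0 \<le> (v + (- 1 / q) *\<^sub>R w) \<bullet> (A *v (v + (- 1 / q) *\<^sub>R w))"
    using pos_def_form_pos[OF A] by (cases "v + (- 1 / q) *\<^sub>R w = 0") (auto intro: less_imp_le)
  also have "\<dots> = v \<bullet> (A *v v) - 2 / q * (w \<bullet> w) + (w \<bullet> (A *v w)) / q\<^sup>2"
    unfolding symmetric_form_add[OF sym] by (simp add: w_def power_divide)
  also have "\<dots> \<le> q * (v \<bullet> v) - 2 / q * (w \<bullet> w) + (q * (w \<bullet> w)) / q\<^sup>2"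
    using form_le_lambda_max[OF sym] q unfolding q_def[symmetric]
    by (intro add_mono diff_mono divide_right_mono) auto
  also have "\<dots> = (q\<^sup>2 * (v \<bullet> v) - w \<bullet> w) / q"
    using q by (simp add: field_simps power2_eq_square)
  finally have "w \<bullet> w \<le> q\<^sup>2 * (v \<bullet> v)"
    using q by (simp add: zero_le_divide_iff)
  then have "(norm w)\<^sup>2 \<le> (q * norm v)\<^sup>2"
    by (simp add: power_mult_distrib dot_square_norm)
  then show ?thesis
    unfolding q_def[symmetric] w_def[symmetric] using q by (simp add: power2_le_iff_abs_le)
qed

lemma lambda_min_pos:
  fixes A :: "real^'n^'n"
  assumes A: "A \<in> pos_def_matrices"
  shows "0 < lambda_min A"
proof -
  note sym = pos_def_symmetric[OF A]
  have "lambda_min A \<in> eigenvalues A"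
    unfolding lambda_min_def
    using minimal_eigenvalue_exists[OF sym] by (intro Min_in finite_eigenvalues[OF sym]) blast
  then obtain v where v: "v \<noteq> 0" "A *v v = lambda_min A *\<^sub>R v"
    by (auto simp: eigenvalues_def)
  then have "0 < lambda_min A * (v \<bullet> v)"
    using pos_def_form_pos[OF A v(1)] by simp
  then show ?thesis
    using inner_ge_zero[of v] by (simp add: zero_less_mult_iff)
qed

section \<open>Gradients, Jacobians and continuity\<close>

lemma gderiv_gradient:
  fixes F :: "'a::euclidean_space \<Rightarrow> real"
  assumes "F differentiable (at z)"
  shows "GDERIV F z :> gradient F z"
proof -
  obtain F' where F': "(F has_derivative F') (at z)"
    using assms unfolding differentiable_def by blast
  have "F' = (\<lambda>v. v \<bullet> adjoint F' 1)"
    using adjoint_works[OF has_derivative_linear[OF F'], of _ 1]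
    by (simp add: fun_eq_iff inner_commute)
  then have ex: "GDERIV F z :> adjoint F' 1"
    using F' unfolding gderiv_def by metis
  have "g = adjoint F' 1" if "GDERIV F z :> g" for g
  proof -
    have "(\<lambda>v. v \<bullet> g) = (\<lambda>v. v \<bullet> adjoint F' 1)"
      using that ex unfolding gderiv_def by (rule has_derivative_unique)
    then show ?thesis by (metis vector_eq_ldot)
  qed
  with ex show ?thesis
    unfolding gradient_def by (rule theI)
qed

lemma gderiv_chain_curve:
  assumes F: "GDERIV F (c t) :> g" and c: "(c has_vector_derivative c') (at t within I)"
  shows "((\<lambda>t. F (c t)) has_real_derivative c' \<bullet> g) (at t within I)"
proof -
  have "(F has_derivative (\<lambda>v. v \<bullet> g)) (at (c t) within c ` I)"
    using F unfolding gderiv_def by (rule has_derivative_at_withinI)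
  from vector_derivative_diff_chain_within[OF c this]
  show ?thesis by (simp add: has_real_derivative_iff_has_vector_derivative o_def)
qed

lemma continuously_differentiable_imp_differentiable:
  "continuously_differentiable F \<Longrightarrow> F differentiable (at z)"
  unfolding continuously_differentiable_def differentiable_def by blast

lemma continuously_differentiable_imp_continuous:
  "continuously_differentiable F \<Longrightarrow> continuous_on UNIV F"
  by (intro continuous_at_imp_continuous_on ballI differentiable_imp_continuous_within
      continuously_differentiable_imp_differentiable)

lemma continuous_on_jacobian:
  fixes h :: "real^'p \<Rightarrow> real^'n"
  assumes "continuously_differentiable h"
  shows "continuous_on UNIV (\<lambda>u. jacobian h (at u))"
proof -
  obtain h' where h': "\<And>u. (h has_derivative blinfun_apply (h' u)) (at u)"
    and cont: "continuous_on UNIV h'"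
    using assms unfolding continuously_differentiable_def by blast
  have "jacobian h (at u) = matrix (blinfun_apply (h' u))" for u
    unfolding jacobian_def using frechet_derivative_at[OF h'] by metis
  moreover have "continuous_on UNIV (\<lambda>u. matrix (blinfun_apply (h' u)))"
    unfolding matrix_def by (intro continuous_intros cont)
  ultimately show ?thesis by simp
qed

lemma locally_lipschitz_imp_continuous:
  assumes "locally_lipschitz F"
  shows "continuous_on UNIV F"
proof (rule continuous_at_imp_continuous_on, rule ballI)
  fix z
  obtain e M where "0 < e" "M-lipschitz_on (ball z e) F"
    using assms unfolding locally_lipschitz_def by blast
  then show "isCont F z"
    using lipschitz_on_continuous_on continuous_on_interior[of "ball z e" F z] by auto
qed

lemma continuous_on_matrix_vector [continuous_intros]:
  fixes A :: "'a::topological_space \<Rightarrow> real^'n^'m"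
  assumes "continuous_on S A" and "continuous_on S v"
  shows "continuous_on S (\<lambda>s. A s *v v s)"
  unfolding matrix_vector_mult_def by (intro continuous_intros assms)

lemma continuous_on_transpose [continuous_intros]:
  fixes A :: "'a::topological_space \<Rightarrow> real^'n^'m"
  assumes "continuous_on S A"
  shows "continuous_on S (\<lambda>s. transpose (A s))"
  unfolding transpose_def by (intro continuous_intros assms)

section \<open>The gain condition\<close>

text \<open>A finite quotient forces the supremum to be finite and the infimum to be positive: as the supremum
  is positive, the quotient is infinite when the infimum is 0.\<close>

lemma ereal_gain_bounds:
  fixes a b :: "'u \<Rightarrow> real"
  assumes a: "\<And>u. 0 < a u" and b: "\<And>u. 0 < b u"
    and less: "(SUP u. ereal (a u)) / (INF u. ereal (b u)) < ereal g"
  shows "\<exists>q d. 0 < d \<and> (\<forall>u. a u \<le> q) \<and> (\<forall>u. d \<le> b u) \<and> q < g * d"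
proof -
  define s where "s = (SUP u. ereal (a u))"
  define i where "i = (INF u. ereal (b u))"
  have s_ge: "ereal (a u) \<le> s" and i_le: "i \<le> ereal (b u)" for u
    unfolding s_def i_def by (auto intro: SUP_upper INF_lower)
  have "0 < s"
    using s_ge[of undefined] a[of undefined] by (metis ereal_less(2) less_le_trans)
  have "0 \<le> i"
    unfolding i_def using b by (intro INF_greatest) (auto intro: less_imp_le)
  with i_le[of undefined] obtain d where d: "i = ereal d" "0 \<le> d"
    by (cases i) auto
  have quot: "s / i < ereal g"
    using less by (simp add: s_def i_def)
  have "d \<noteq> 0"
    using quot \<open>0 < s\<close> by (auto simp: d divide_ereal_def split: if_splits)
  with d have "0 < d" by simp
  obtain q where q: "s = ereal q"
    using quot \<open>0 < s\<close> \<open>0 < d\<close> by (cases s) (auto simp: d divide_ereal_def)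
  have "q < g * d"
    using quot \<open>0 < d\<close> by (simp add: q d field_simps)
  moreover have "a u \<le> q" "d \<le> b u" for u
    using s_ge[of u] i_le[of u] by (simp_all add: q d)
  ultimately show ?thesis using \<open>0 < d\<close> by blast
qed

text \<open>The form \<open>A a\<^sup>2 - 2 C a b + B b\<^sup>2\<close> has positive determinant, hence is positive definite, and lowering
  both diagonal entries by a small \<open>\<epsilon>\<close> keeps it semidefinite.\<close>

lemma negative_definite_margin:
  fixes A B C :: real
  assumes A: "0 < A" and B: "0 < B" and C: "C\<^sup>2 < A * B"
  shows "\<exists>\<epsilon>>0. \<forall>a b. 2 * C * a * b - A * a\<^sup>2 - B * b\<^sup>2 \<le> - \<epsilon> * (a\<^sup>2 + b\<^sup>2)"
proof -
  \<comment> \<open>With this \<open>\<epsilon>\<close> the reduced determinant \<open>(A - \<epsilon>) (B - \<epsilon>) - C\<^sup>2\<close> is \<open>\<epsilon>\<^sup>2\<close>.\<close>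
  define \<epsilon> where "\<epsilon> = (A * B - C\<^sup>2) / (A + B)"
  have \<epsilon>: "0 < \<epsilon>" using A B C by (simp add: \<epsilon>_def)
  have sum: "\<epsilon> * (A + B) = A * B - C\<^sup>2" using A B by (simp add: \<epsilon>_def)
  have "\<epsilon> \<le> A * B / (A + B)"
    unfolding \<epsilon>_def using A B by (intro divide_right_mono) auto
  also have "\<dots> < A" using A B by (simp add: field_simps)
  finally have P: "0 < A - \<epsilon>" by simp
  have det: "C\<^sup>2 \<le> (A - \<epsilon>) * (B - \<epsilon>)"
  proof -
    have "(A - \<epsilon>) * (B - \<epsilon>) = A * B - \<epsilon> * (A + B) + \<epsilon>\<^sup>2"
      by (simp add: algebra_simps power2_eq_square)
    then show ?thesis using sum by simp
  qed
  have "2 * C * a * b - A * a\<^sup>2 - B * b\<^sup>2 \<le> - \<epsilon> * (a\<^sup>2 + b\<^sup>2)" for a b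
  proof -
    have "0 \<le> ((A - \<epsilon>) * a - C * b)\<^sup>2 + ((A - \<epsilon>) * (B - \<epsilon>) - C\<^sup>2) * b\<^sup>2"
      using det by simp
    also have "\<dots> = (A - \<epsilon>) * ((A - \<epsilon>) * a\<^sup>2 - 2 * C * a * b + (B - \<epsilon>) * b\<^sup>2)"
      by (simp add: power2_eq_square algebra_simps)
    finally have "0 \<le> (A - \<epsilon>) * a\<^sup>2 - 2 * C * a * b + (B - \<epsilon>) * b\<^sup>2"
      using P by (simp add: zero_le_mult_iff)
    then show ?thesis by (simp add: algebra_simps)
  qed
  with \<epsilon> show ?thesis by blast
qed

section \<open>The Lyapunov function of the closed loop\<close>

lemma HT_apply_diff: "HT_apply h u (v - w) = HT_apply h u v - HT_apply h u w"
  by (simp add: HT_apply_def matrix_vector_mult_diff_distrib)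

text \<open>The first block of the stationarity condition determines the multiplier as minus the partial
  gradient with respect to \<open>x\<close>; what remains is the second block.\<close>

lemma critical_point_iff:
  "critical_point \<Phi> h (x, u) \<longleftrightarrow> x = h u \<and> HT_apply h u (gradient \<Phi> (x, u)) = 0"
proof -
  let ?g = "gradient \<Phi> (x, u)" and ?J = "transpose (jacobian h (at u))"
  have "(\<exists>lam. ?g + (lam, - (?J *v lam)) = 0) \<longleftrightarrow> HT_apply h u ?g = 0"
  proof
    assume "\<exists>lam. ?g + (lam, - (?J *v lam)) = 0"
    then obtain lam where "fst ?g + lam = 0" "snd ?g - ?J *v lam = 0"
      by (auto simp: prod_eq_iff)
    then have "lam = - fst ?g" "snd ?g = ?J *v lam"
      by (simp_all add: eq_neg_iff_add_eq_0 add.commute)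
    then show "HT_apply h u ?g = 0"
      using matrix_vector_mult_diff_distrib[of ?J 0 "fst ?g"] by (simp add: HT_apply_def)
  next
    assume "HT_apply h u ?g = 0"
    then have "?g + (- fst ?g, - (?J *v (- fst ?g))) = 0"
      using matrix_vector_mult_diff_distrib[of ?J 0 "fst ?g"]
      by (simp add: HT_apply_def prod_eq_iff add.commute)
    then show "\<exists>lam. ?g + (lam, - (?J *v lam)) = 0" by blast
  qed
  then show ?thesis by (simp add: critical_point_def)
qed

text \<open>The gain condition enters through the uniform bounds \<open>q\<close> on the squared largest eigenvalues of \<open>Q\<close>
  and \<open>d\<close> on the smallest eigenvalues of \<open>D\<close>.\<close>

locale small_gain_loop =
  fixes f :: "(real^'n) \<times> (real^'p) \<Rightarrow> real^'n"
    and h :: "real^'p \<Rightarrow> real^'n"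
    and \<Phi> W :: "(real^'n) \<times> (real^'p) \<Rightarrow> real"
    and Q D :: "real^'p \<Rightarrow> real^'p^'p"
    and L \<alpha> \<beta> \<gamma> \<zeta> q d :: real
  assumes f_cont: "continuous_on UNIV f"
    and h_C1: "continuously_differentiable h"
    and Phi_C1: "continuously_differentiable \<Phi>"
    and grad_cont: "continuous_on UNIV (gradient \<Phi>)"
    and Q_pd: "\<And>u. Q u \<in> pos_def_matrices" and Q_cont: "continuous_on UNIV Q"
    and D_pd: "\<And>u. D u \<in> pos_def_matrices" and D_cont: "continuous_on UNIV D"
    and L_pos: "L > 0"
    and L_bound: "\<And>x x' u. norm (HT_apply h u (gradient \<Phi> (x', u) - gradient \<Phi> (x, u)))
                   \<le> L * norm (x' - x)"
    and lyap: "lyapunov_function f h W \<alpha> \<beta> \<gamma> \<zeta>"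
    and sublevel: "\<And>c. compact {u. \<Phi> (h u, u) \<le> c}"
    and d_pos: "0 < d"
    and Q_le: "\<And>u. (lambda_max (Q u))\<^sup>2 \<le> q"
    and D_ge: "\<And>u. d \<le> lambda_min (D u)"
    and gain: "q < \<gamma> / (\<zeta> * L) * d"
begin

definition F :: "(real^'n) \<times> (real^'p) \<times> (real^'p) \<Rightarrow> (real^'n) \<times> (real^'p) \<times> (real^'p)"
  where "F = closed_loop f h \<Phi> Q D"

text \<open>The weight \<open>L / \<zeta>\<close> balances the two cross terms in \<open>\<bar>z\<bar> \<bar>x - h u\<bar>\<close>, both of which become
  \<open>L \<lambda>max(Q u)\<close>. With this choice the condition for a negative definite derivative is the gain
  condition.\<close>

definition V :: "(real^'n) \<times> (real^'p) \<times> (real^'p) \<Rightarrow> real"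
  where "V = (\<lambda>(x, u, z). \<Phi> (h u, u) + (z \<bullet> z) / 2 + L / \<zeta> * W (x, u))"

text \<open>The derivative of \<open>V\<close> along the closed loop, as a function of the state: its sign can then be
  discussed without reference to a trajectory.\<close>

definition V' :: "(real^'n) \<times> (real^'p) \<times> (real^'p) \<Rightarrow> real"
  where "V' = (\<lambda>(x, u, z).
     (Q u *v z) \<bullet> HT_apply h u (gradient \<Phi> (h u, u)) +
     z \<bullet> (- (D u *v z) - Q u *v HT_apply h u (gradient \<Phi> (x, u))) +
     L / \<zeta> * ((f (x, u), Q u *v z) \<bullet> gradient W (x, u)))"

definition dissipation :: "(real^'n) \<times> (real^'p) \<times> (real^'p) \<Rightarrow> real"
  where "dissipation = (\<lambda>(x, u, z). (norm z)\<^sup>2 + (norm (x - h u))\<^sup>2)"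

lemma
  shows lyap_pos: "0 < \<alpha>" "0 < \<gamma>" "0 < \<zeta>"
    and W_differentiable: "W differentiable (at s)"
    and W_ge: "\<alpha> * (norm (x - h u))\<^sup>2 \<le> W (x, u)"
    and W_plant_decay: "fst (gradient W (x, u)) \<bullet> f (x, u) \<le> - \<gamma> * (norm (x - h u))\<^sup>2"
    and W_input_slope: "norm (snd (gradient W (x, u))) \<le> \<zeta> * norm (x - h u)"
  using lyap unfolding lyapunov_function_def by blast+

lemma h_cont: "continuous_on UNIV h"
  by (rule continuously_differentiable_imp_continuous[OF h_C1])

lemma reduced_cost_cont: "continuous_on UNIV (\<lambda>u. \<Phi> (h u, u))"
  by (intro continuous_on_compose2[OF continuously_differentiable_imp_continuous[OF Phi_C1]]
      continuous_intros h_cont) auto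

lemma continuous_on_HT_apply:
  assumes "continuous_on S u" and "continuous_on S w"
  shows "continuous_on S (\<lambda>s. HT_apply h (u s) (w s))"
  unfolding HT_apply_def
  by (intro continuous_intros continuous_on_compose2[OF continuous_on_jacobian[OF h_C1]] assms) auto

lemma F_cont: "continuous_on UNIV F"
  unfolding F_def closed_loop_def split_beta
  by (intro continuous_intros continuous_on_HT_apply continuous_on_compose2[OF f_cont]
      continuous_on_compose2[OF Q_cont] continuous_on_compose2[OF D_cont]
      continuous_on_compose2[OF grad_cont]) auto

lemma dissipation_cont: "continuous_on UNIV dissipation"
  unfolding dissipation_def split_beta
  by (intro continuous_intros continuous_on_compose2[OF h_cont]) auto

text \<open>The gradient of the reduced cost \<open>u \<mapsto> \<Phi> (h u, u)\<close> is \<open>H(u)\<^sup>T \<nabla>\<Phi>(h u, u)\<close>, by the chain rule and the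
  adjoint of the Jacobian of \<open>h\<close>.\<close>

lemma reduced_cost_derivative:
  assumes u: "(u has_vector_derivative u') (at t within I)"
  shows "((\<lambda>t. \<Phi> (h (u t), u t)) has_real_derivative
           u' \<bullet> HT_apply h (u t) (gradient \<Phi> (h (u t), u t))) (at t within I)"
proof -
  let ?J = "jacobian h (at (u t))"
  have "h differentiable (at (u t))"
    by (rule continuously_differentiable_imp_differentiable[OF h_C1])
  then have "(h has_derivative (\<lambda>v. ?J *v v)) (at (u t) within u ` I)"
    using jacobian_works has_derivative_at_withinI by blast
  from vector_derivative_diff_chain_within[OF u this]
  have "((\<lambda>t. (h (u t), u t)) has_vector_derivative (?J *v u', u')) (at t within I)"
    unfolding o_def by (rule has_vector_derivative_Pair[OF _ u])
  from gderiv_chain_curve[OF gderiv_gradient this]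
  have "((\<lambda>t. \<Phi> (h (u t), u t)) has_real_derivative
           (?J *v u', u') \<bullet> gradient \<Phi> (h (u t), u t)) (at t within I)"
    using continuously_differentiable_imp_differentiable[OF Phi_C1] by blast
  moreover have "(?J *v u', u') \<bullet> g = u' \<bullet> HT_apply h (u t) g" for g
    using inner_matrix_swap[of "fst g" ?J u']
    by (simp add: inner_prod_def HT_apply_def inner_add_right inner_commute)
  ultimately show ?thesis by simp
qed

lemma V_derivative:
  assumes y: "(y has_vector_derivative F (y t)) (at t within I)"
  shows "((\<lambda>t. V (y t)) has_real_derivative V' (y t)) (at t within I)"
proof -
  define x where "x = (\<lambda>t. fst (y t))"
  define u where "u = (\<lambda>t. fst (snd (y t)))"
  define z where "z = (\<lambda>t. snd (snd (y t)))"
  have y_eq: "y t = (x t, u t, z t)" for t by (simp add: x_def u_def z_def)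
  have fst': "bounded_linear fst" and snd': "bounded_linear snd"
    by (rule bounded_linear_fst bounded_linear_snd)+
  have x: "(x has_vector_derivative f (x t, u t)) (at t within I)"
    using bounded_linear.has_vector_derivative[OF fst' y]
    by (simp add: x_def[symmetric] y_eq F_def closed_loop_def)
  note sy = bounded_linear.has_vector_derivative[OF snd' y]
  have u: "(u has_vector_derivative Q (u t) *v z t) (at t within I)"
    using bounded_linear.has_vector_derivative[OF fst' sy]
    by (simp add: u_def[symmetric] y_eq F_def closed_loop_def)
  let ?z' = "- (D (u t) *v z t) - Q (u t) *v HT_apply h (u t) (gradient \<Phi> (x t, u t))"
  have z: "(z has_vector_derivative ?z') (at t within I)"
    using bounded_linear.has_vector_derivative[OF snd' sy]
    by (simp add: z_def[symmetric] y_eq F_def closed_loop_def)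
  have zz: "((\<lambda>t. (z t \<bullet> z t) / 2) has_real_derivative z t \<bullet> ?z') (at t within I)"
    using has_vector_derivative_mult_right[of "\<lambda>t. z t \<bullet> z t", OF
        bounded_bilinear.has_vector_derivative[OF bounded_bilinear_inner z z], of "1/2"]
    by (simp add: has_real_derivative_iff_has_vector_derivative inner_commute)
  have "((\<lambda>t. (x t, u t)) has_vector_derivative (f (x t, u t), Q (u t) *v z t)) (at t within I)"
    by (rule has_vector_derivative_Pair[OF x u])
  from gderiv_chain_curve[OF gderiv_gradient[OF W_differentiable] this]
  have W: "((\<lambda>t. W (x t, u t)) has_real_derivative
      (f (x t, u t), Q (u t) *v z t) \<bullet> gradient W (x t, u t)) (at t within I)" .
  show ?thesis
    unfolding y_eq V_def V'_def prod.case
    by (intro DERIV_add DERIV_cmult reduced_cost_derivative[OF u] zz W)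
qed

text \<open>By symmetry of \<open>Q u\<close>, the coupling between \<open>u\<close> and \<open>z\<close> cancels up to the difference of
  \<open>H(u)\<^sup>T \<nabla>\<Phi>\<close> at \<open>h u\<close> and at \<open>x\<close>, which is at most \<open>L \<bar>x - h u\<bar>\<close>.\<close>

lemma V'_le_form:
  "V' (x, u, z) \<le> 2 * (L * sqrt q) * norm z * norm (x - h u)
     - d * (norm z)\<^sup>2 - L * \<gamma> / \<zeta> * (norm (x - h u))\<^sup>2"
proof -
  define a where "a = norm z"
  define b where "b = norm (x - h u)"
  have ab: "0 \<le> a" "0 \<le> b" by (simp_all add: a_def b_def)
  define G where "G = (\<lambda>x. HT_apply h u (gradient \<Phi> (x, u)))"
  have "lambda_max (Q u) \<le> sqrt q"
    using Q_le[of u] by (rule real_le_rsqrt)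
  then have Qz: "norm (Q u *v z) \<le> sqrt q * a"
    using norm_pos_def_le_lambda_max[OF Q_pd, of u z] ab(1)
    by (smt (verit) a_def mult_right_mono)
  have Dz: "d * a\<^sup>2 \<le> z \<bullet> (D u *v z)"
  proof -
    have "d * a\<^sup>2 \<le> lambda_min (D u) * (z \<bullet> z)"
      using D_ge[of u] by (simp add: a_def dot_square_norm mult_right_mono)
    also have "\<dots> \<le> z \<bullet> (D u *v z)"
      by (rule lambda_min_form_le[OF pos_def_symmetric[OF D_pd]])
    finally show ?thesis .
  qed
  have inner_le: "v \<bullet> w \<le> c * c'" if "norm v \<le> c" "norm w \<le> c'" for v w :: "real^'p" and c c'
    using mult_mono'[OF that] norm_cauchy_schwarz[of v w] by simp
  have "norm (G (h u) - G x) \<le> L * b"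
    using L_bound[of u "h u" x] by (simp add: G_def HT_apply_diff b_def norm_minus_commute)
  then have cross: "(Q u *v z) \<bullet> (G (h u) - G x) \<le> sqrt q * a * (L * b)"
    by (rule inner_le[OF Qz])
  have "z \<bullet> (Q u *v G x) = (Q u *v z) \<bullet> G x"
    using inner_matrix_swap[of z "Q u" "G x"] pos_def_symmetric[OF Q_pd[of u]] by simp
  then have energy: "(Q u *v z) \<bullet> G (h u) + z \<bullet> (- (D u *v z) - Q u *v G x)
      \<le> sqrt q * a * (L * b) - d * a\<^sup>2"
    using cross Dz by (simp add: inner_diff_right)
  have "(Q u *v z) \<bullet> snd (gradient W (x, u)) \<le> (sqrt q * a) * (\<zeta> * b)"
    unfolding b_def by (rule inner_le[OF Qz W_input_slope])
  then have "(f (x, u), Q u *v z) \<bullet> gradient W (x, u) \<le> sqrt q * a * (\<zeta> * b) - \<gamma> * b\<^sup>2"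
    using W_plant_decay[of x u] by (simp add: inner_prod_def inner_commute b_def)
  then have "L / \<zeta> * ((f (x, u), Q u *v z) \<bullet> gradient W (x, u))
      \<le> L / \<zeta> * (sqrt q * a * (\<zeta> * b) - \<gamma> * b\<^sup>2)"
    using L_pos lyap_pos by (intro mult_left_mono) auto
  also have "\<dots> = L * sqrt q * a * b - L * \<gamma> / \<zeta> * b\<^sup>2"
    using lyap_pos by (simp add: field_simps)
  finally show ?thesis
    using energy unfolding V'_def prod.case a_def[symmetric] b_def[symmetric] G_def
    by (simp add: algebra_simps)
qed

lemma V'_le_dissipation: "\<exists>\<epsilon>>0. \<forall>s. V' s \<le> - \<epsilon> * dissipation s"
proof -
  have q: "0 \<le> q" using Q_le[of undefined] by (rule order_trans[OF zero_le_power2])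
  have "(L * sqrt q)\<^sup>2 < d * (L * \<gamma> / \<zeta>)"
  proof -
    have "L\<^sup>2 * q < L\<^sup>2 * (\<gamma> / (\<zeta> * L) * d)"
      using gain L_pos by (intro mult_strict_left_mono) auto
    also have "\<dots> = d * (L * \<gamma> / \<zeta>)"
      using L_pos lyap_pos by (simp add: field_simps power2_eq_square)
    finally show ?thesis using q by (simp add: power_mult_distrib)
  qed
  moreover have "0 < L * \<gamma> / \<zeta>" using L_pos lyap_pos by simp
  ultimately obtain \<epsilon> where "0 < \<epsilon>" and
    "\<forall>a b. 2 * (L * sqrt q) * a * b - d * a\<^sup>2 - L * \<gamma> / \<zeta> * b\<^sup>2 \<le> - \<epsilon> * (a\<^sup>2 + b\<^sup>2)"
    using negative_definite_margin[OF d_pos] by blast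
  then have "V' (x, u, z) \<le> - \<epsilon> * dissipation (x, u, z)" for x u z
    using V'_le_form[of x u z] unfolding dissipation_def prod.case by (meson order_trans)
  with \<open>0 < \<epsilon>\<close> show ?thesis by (metis prod_cases3)
qed

lemma V'_nonpos: "V' s \<le> 0"
proof -
  obtain \<epsilon> where "0 < \<epsilon>" "V' s \<le> - \<epsilon> * dissipation s"
    using V'_le_dissipation by blast
  moreover have "0 \<le> dissipation s"
    by (simp add: dissipation_def split_beta)
  ultimately show ?thesis
    by (smt (verit) mult_nonneg_nonneg mult_minus_left)
qed

text \<open>Since \<open>W \<ge> 0\<close>, a sublevel set of \<open>V\<close> projects into one of the reduced cost, which is compact. There
  the reduced cost is bounded below, so both other terms of \<open>V\<close> are bounded, and with them \<open>z\<close> and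
  \<open>x - h u\<close>.\<close>

lemma V_sublevel:
  shows "bounded {s. V s \<le> c}" and "\<exists>m. \<forall>s. V s \<le> c \<longrightarrow> m \<le> V s"
proof -
  define S where "S = {u. \<Phi> (h u, u) \<le> c}"
  have S: "compact S" unfolding S_def by (rule sublevel)
  have V_ge: "\<Phi> (h u, u) + (norm z)\<^sup>2 / 2 + L / \<zeta> * (\<alpha> * (norm (x - h u))\<^sup>2) \<le> V (x, u, z)"
    for x u z
    unfolding V_def prod.case
    using L_pos lyap_pos by (auto simp: dot_square_norm intro!: mult_left_mono divide_right_mono W_ge)
  have pos: "0 \<le> L / \<zeta> * (\<alpha> * (norm (x - h u))\<^sup>2)" for x u
    using L_pos lyap_pos by simp
  have V_ge': "\<Phi> (h u, u) \<le> V (x, u, z)" for x u z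
    using V_ge[of u z x] pos[of x u] zero_le_power2[of "norm z"] by linarith
  have "bounded ((\<lambda>u. \<Phi> (h u, u)) ` S)"
    by (intro compact_imp_bounded compact_continuous_image S
        continuous_on_subset[OF reduced_cost_cont]) auto
  then obtain m0 where m0: "\<And>u. u \<in> S \<Longrightarrow> \<bar>\<Phi> (h u, u)\<bar> \<le> m0"
    unfolding bounded_iff by auto
  have in_S: "u \<in> S" if "V (x, u, z) \<le> c" for x u z
    using that V_ge'[of u x z] unfolding S_def by simp
  show "\<exists>m. \<forall>s. V s \<le> c \<longrightarrow> m \<le> V s"
  proof (intro exI allI impI)
    fix s assume s: "V s \<le> c"
    obtain x u z where eq: "s = (x, u, z)" by (rule prod_cases3)
    show "- m0 \<le> V s"
      using m0[OF in_S[of x u z]] V_ge'[of u x z] s unfolding eq by linarith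
  qed
  obtain Bu where Bu: "\<And>u. u \<in> S \<Longrightarrow> norm u \<le> Bu"
    using compact_imp_bounded[OF S] unfolding bounded_iff by blast
  have "bounded (h ` S)"
    by (intro compact_imp_bounded compact_continuous_image S continuous_on_subset[OF h_cont]) auto
  then obtain Bh where Bh: "\<And>u. u \<in> S \<Longrightarrow> norm (h u) \<le> Bh"
    unfolding bounded_iff by blast
  define k where "k = L / \<zeta> * \<alpha>"
  have k: "0 < k" using L_pos lyap_pos by (simp add: k_def)
  show "bounded {s. V s \<le> c}"
    unfolding bounded_iff
  proof (intro exI ballI)
    fix s assume s: "s \<in> {s. V s \<le> c}"
    obtain x u z where eq: "s = (x, u, z)" by (rule prod_cases3)
    have V: "V (x, u, z) \<le> c" using s eq by simp
    note u = in_S[OF V]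
    have le: "(norm z)\<^sup>2 / 2 + k * (norm (x - h u))\<^sup>2 \<le> c + m0"
      using V_ge[of u z x] V m0[OF u] by (simp add: k_def mult.assoc)
    have z: "norm z \<le> sqrt (2 * (c + m0))"
      using le k by (intro real_le_rsqrt) (smt (verit) field_sum_of_halves mult_nonneg_nonneg zero_le_power2)
    have "k * (norm (x - h u))\<^sup>2 \<le> c + m0"
      using le zero_le_power2[of "norm z"] by linarith
    then have "norm (x - h u) \<le> sqrt ((c + m0) / k)"
      using k by (intro real_le_rsqrt) (simp add: field_simps)
    then have x: "norm x \<le> sqrt ((c + m0) / k) + Bh"
      using norm_triangle_sub[of x "h u"] Bh[OF u] by linarith
    have "norm s \<le> norm x + (norm u + norm z)"
      unfolding eq using norm_Pair_le[of x "(u, z)"] norm_Pair_le[of u z] by linarith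
    then show "norm s \<le> (sqrt ((c + m0) / k) + Bh) + (Bu + sqrt (2 * (c + m0)))"
      using x z Bu[OF u] by linarith
  qed
qed

lemma V_antitone:
  assumes sol: "solves_on I F y" and I: "{a..b} \<subseteq> I" and "a \<le> b"
  shows "V (y b) \<le> V (y a)"
proof -
  have "V (y b) \<le> V (y a) - 0 * (b - a)"
  proof (rule decrease_at_rate[OF \<open>a \<le> b\<close>])
    fix t assume t: "t \<in> {a..b}"
    then have "(y has_vector_derivative F (y t)) (at t within {a..b})"
      using solves_on_subset[OF sol I] unfolding solves_on_def by blast
    then show "((\<lambda>t. V (y t)) has_real_derivative V' (y t)) (at t within {a..b})"
      by (rule V_derivative)
  qed (simp add: V'_nonpos)
  then show ?thesis by simp
qed

lemma orbit_in_sublevel: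
  assumes "solves_on (time_interval T) F y" and "t \<in> time_interval T"
  shows "V (y t) \<le> V (y 0)"
  using assms by (intro V_antitone[of "time_interval T"])
    (auto simp: time_interval_def intro: le_less_trans[of _ "ereal t"])

lemma orbit_bounded:
  assumes "solves_on (time_interval T) F y"
  shows "bounded (y ` time_interval T)"
  by (rule bounded_subset[OF V_sublevel(1)[of "V (y 0)"]]) (use orbit_in_sublevel[OF assms] in auto)

text \<open>Barbalat's lemma is used twice: for \<open>V\<close>, giving \<open>z \<rightarrow> 0\<close> and \<open>x - h u \<rightarrow> 0\<close>, and then for \<open>z\<close>, giving
  \<open>z' \<rightarrow> 0\<close>. These are three continuous functions of the state, and they vanish together exactly at
  the critical points with \<open>z = 0\<close>.\<close>

lemma global_convergence:
  assumes sol: "solves_on {0..} F y"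
  shows "converges_to_set y {(x, u, z). z = 0 \<and> critical_point \<Phi> h (x, u)}"
proof -
  have half_line: "time_interval \<infinity> = {0..}"
    by (auto simp: time_interval_def)
  have bdd: "bounded (y ` {0..})"
    using orbit_bounded[of \<infinity> y] sol unfolding half_line .
  obtain C where "C-lipschitz_on {0..} y"
    using solution_lipschitz_on[OF sol _ F_cont bdd] by auto
  then have unif: "uniformly_continuous_on {0..} y"
    by (rule lipschitz_on_uniformly_continuous)
  obtain \<epsilon> where \<epsilon>: "0 < \<epsilon>" and V'_le: "\<And>s. V' s \<le> - (\<epsilon> * dissipation s)"
    using V'_le_dissipation by auto
  obtain m where m: "\<And>s. V s \<le> V (y 0) \<Longrightarrow> m \<le> V s"
    using V_sublevel(2) by blast
  obtain l where V_lim: "((\<lambda>t. V (y t)) \<longlongrightarrow> l) at_top"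
  proof -
    have "\<exists>l. ((\<lambda>t. V (y t)) \<longlongrightarrow> l) at_top"
    proof (rule antitone_bounded_below_converges)
      show "V (y t) \<le> V (y s)" if "0 \<le> s" "s \<le> t" for s t
        using that by (intro V_antitone[OF sol]) auto
      then show "m \<le> V (y t)" if "0 \<le> t" for t
        using that by (intro m) auto
    qed
    then show ?thesis using that by blast
  qed
  have dissip: "((\<lambda>t. dissipation (y t)) \<longlongrightarrow> 0) at_top"
  proof (rule tendstoI)
    fix e :: real assume e: "0 < e"
    have "\<forall>\<^sub>F t in at_top. \<epsilon> * dissipation (y t) < \<epsilon> * e"
    proof (rule barbalat[OF V_derivative V'_le _ V_lim])
      show "(y has_vector_derivative F (y t)) (at t within {0..})" if "0 \<le> t" for t
        using sol that unfolding solves_on_def by simp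
      show "uniformly_continuous_on {0..} (\<lambda>t. \<epsilon> * dissipation (y t))"
        by (rule uniformly_continuous_on_compose_bounded[OF _ bdd unif])
          (intro continuous_intros dissipation_cont)
    qed (use e \<epsilon> in simp)
    then show "\<forall>\<^sub>F t in at_top. dist (dissipation (y t)) 0 < e"
    proof eventually_elim
      case (elim t)
      moreover have "0 \<le> dissipation (y t)" by (simp add: dissipation_def split_beta)
      ultimately show ?case using \<epsilon> by (simp add: dist_real_def)
    qed
  qed
  define z where "z = (\<lambda>t. snd (snd (y t)))"
  define r where "r = (\<lambda>t. fst (y t) - h (fst (snd (y t))))"
  have dissip_eq: "dissipation (y t) = (norm (z t))\<^sup>2 + (norm (r t))\<^sup>2" for t
    by (simp add: dissipation_def z_def r_def split_beta)
  have sqrt_lim: "((\<lambda>t. sqrt (dissipation (y t))) \<longlongrightarrow> 0) at_top"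
    using tendsto_real_sqrt[OF dissip] by simp
  have z_lim: "(z \<longlongrightarrow> 0) at_top" and r_lim: "(r \<longlongrightarrow> 0) at_top"
    by (rule Lim_null_comparison[OF _ sqrt_lim]; simp add: dissip_eq real_le_rsqrt)+
  define z' where "z' = (\<lambda>t. snd (snd (F (y t))))"
  have z'_lim: "(z' \<longlongrightarrow> 0) at_top"
  proof (rule barbalat_derivative[OF _ _ z_lim])
    show "(z has_vector_derivative z' t) (at t within {0..})" if "0 \<le> t" for t
    proof -
      have "(y has_vector_derivative F (y t)) (at t within {0..})"
        using sol that unfolding solves_on_def by simp
      then show ?thesis unfolding z_def z'_def
        by (intro bounded_linear.has_vector_derivative[OF bounded_linear_snd])
    qed
    show "uniformly_continuous_on {0..} z'"
      unfolding z'_def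
      by (rule uniformly_continuous_on_compose_bounded[OF _ bdd unif])
        (intro continuous_intros F_cont)
  qed
  define N where "N = (\<lambda>s. (fst s - h (fst (snd s)), snd (snd s), snd (snd (F s))))"
  have "continuous_on UNIV N"
    unfolding N_def by (intro continuous_intros F_cont continuous_on_compose2[OF h_cont]) auto
  moreover have "((\<lambda>t. N (y t)) \<longlongrightarrow> 0) at_top"
    using tendsto_Pair[OF r_lim tendsto_Pair[OF z_lim z'_lim]]
    by (simp add: N_def r_def z_def z'_def zero_prod_def)
  ultimately have "converges_to_set y {s. N s = 0}"
    by (rule converges_to_zero_set[OF bdd])
  moreover have "N s = 0 \<longleftrightarrow> s \<in> {(x, u, z). z = 0 \<and> critical_point \<Phi> h (x, u)}" for s
  proof -
    obtain x u z where s: "s = (x, u, z)" by (rule prod_cases3)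
    show ?thesis
      by (simp add: s N_def F_def closed_loop_def critical_point_iff zero_prod_def
          pos_def_kernel[OF Q_pd] cong: conj_cong) blast
  qed
  ultimately show ?thesis by simp
qed

end

section \<open>Convergence to the critical points\<close>

theorem mainTheorem4:
  fixes f :: "(real^'n) \<times> (real^'p) \<Rightarrow> real^'n"
    and h :: "real^'p \<Rightarrow> real^'n"
    and \<Phi> W :: "(real^'n) \<times> (real^'p) \<Rightarrow> real"
    and Q D :: "real^'p \<Rightarrow> real^'p^'p"
    and lx lu l L \<alpha> \<beta> \<gamma> \<zeta> :: real
  assumes plant: "plant_assumption f h lx lu l"
    and Phi_C1: "continuously_differentiable \<Phi>"
    and grad_Phi: "locally_lipschitz (gradient \<Phi>)"
    and Q_pd: "\<And>u. Q u \<in> pos_def_matrices" and Q_cont: "continuous_on UNIV Q"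
    and D_pd: "\<And>u. D u \<in> pos_def_matrices" and D_cont: "continuous_on UNIV D"
    and L_pos: "L > 0"
    and L_bound: "\<And>x x' u. norm (HT_apply h u (gradient \<Phi> (x', u) - gradient \<Phi> (x, u)))
                   \<le> L * norm (x' - x)"
    and lyap: "lyapunov_function f h W \<alpha> \<beta> \<gamma> \<zeta>"
    and sublevel: "\<And>c. compact {u. \<Phi> (h u, u) \<le> c}"
    and gain: "(SUP u. ereal ((lambda_max (Q u))\<^sup>2)) / (INF u. ereal (lambda_min (D u)))
                 < ereal (\<gamma> / (\<zeta> * L))"
  shows "\<forall>T y. trajectory (closed_loop f h \<Phi> Q D) T y \<longrightarrow>
           T = \<infinity> \<and>
           converges_to_set y {(x, u, z). z = 0 \<and> critical_point \<Phi> h (x, u)}"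
proof -
  have "0 < (lambda_max (Q u))\<^sup>2" "0 < lambda_min (D u)" for u
    using lambda_max_pos[OF Q_pd[of u]] lambda_min_pos[OF D_pd[of u]] by simp_all
  from ereal_gain_bounds[OF this gain] obtain q d where bounds: "0 < d"
    "\<And>u. (lambda_max (Q u))\<^sup>2 \<le> q" "\<And>u. d \<le> lambda_min (D u)" "q < \<gamma> / (\<zeta> * L) * d"
    by blast
  have f_C1: "continuously_differentiable f" and h_C1: "continuously_differentiable h"
    using plant unfolding plant_assumption_def by blast+
  interpret small_gain_loop f h \<Phi> W Q D L \<alpha> \<beta> \<gamma> \<zeta> q d
  proof
    show "continuous_on UNIV f" "continuous_on UNIV (gradient \<Phi>)"
      by (rule continuously_differentiable_imp_continuous[OF f_C1]
          locally_lipschitz_imp_continuous[OF grad_Phi])+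
  qed (rule h_C1 Phi_C1 Q_pd Q_cont D_pd D_cont L_pos L_bound lyap sublevel bounds)+
  show ?thesis
  proof (intro allI impI)
    fix T y assume traj: "trajectory (closed_loop f h \<Phi> Q D) T y"
    then have sol: "solves_on (time_interval T) F y"
      unfolding trajectory_def F_def by blast
    have T: "T = \<infinity>"
      using bounded_trajectory_global[OF F_cont _ orbit_bounded[OF sol]] traj
      unfolding F_def by blast
    moreover have "time_interval \<infinity> = {0..}"
      by (auto simp: time_interval_def)
    ultimately show "T = \<infinity> \<and>
        converges_to_set y {(x, u, z). z = 0 \<and> critical_point \<Phi> h (x, u)}"
      using global_convergence sol by auto
  qed
qed

end
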